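(* Let $q\ge4$ and let $i,j,n$ be integers with $0\le i\le j\le n$ and $i+j>n$. Let $f:\Sigma_q^n\to\mathbb{R}$ with $f\in U_{[i,j]}(n,q)$ and $f\not\equiv0$. Then $|f|\ge 2^{i}(q-1)^{n-j}$. Moreover, if $i=j$ and $q\ge5$, then $|f|=2^{i}(q-1)^{n-i}$ holds if and only if $f_\sigma\in F_2(n,q,i,i)$ for some permutation $\sigma\in S_n$.
   Context: $\Sigma_q=\{0,1,\dots,q-1\}$. The Hamming graph $H(n,q)$ has vertex set $\Sigma_q^n$, two vertices being adjacent iff they differ in exactly one coordinate. A function $f:\Sigma_q^n\to\mathbb{R}$ is a $\lambda$-eigenfunction of $H(n,q)$ if $\lambda f(x)=\sum_{y\text{ adjacent to }x}f(y)$ for all $x$. $\lambda_t(n,q)=n(q-1)-qt$ and $U_t(n,q)$ is the space of $\lambda_t(n,q)$-eigenfunctions of $H(n,q)$; for $i\le j$, $U_{[i,j]}(n,q)=U_i(n,q)\oplus\cdots\oplus U_j(n,q)$. $|f|$ is the number of $x$ with $f(x)\ne0$. For $\sigma\in S_n$, $f_\sigma(x_1,\dots,x_n)=f(x_{\sigma(1)},\dots,x_{\sigma(n)})$. For $k,m\in\Sigma_q$, $a_1(k,m):\Sigma_q^2\to\mathbb{R}$ is $1$ if $x=k,y\ne m$; $-1$ if $y=m,x\ne k$; $0$ otherwise; $A_1$ is the set of all $a_1(k,m)$. For $k\ne m$ in $\Sigma_q$, $a_2(k,m):\Sigma_q\to\mathbb{R}$ is $1$ at $k$, $-1$ at $m$,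 $0$ elsewhere; $A_2$ is the set of all such. For $m\in\Sigma_q$, $a_4(m)$ is the indicator of $\{m\}$ on $\Sigma_q$; $A_4$ is the set of all such. Products of functions on $\Sigma_q^{n_1},\dots,\Sigma_q^{n_s}$ are functions on $\Sigma_q^{n_1+\dots+n_s}$ given by $(x^{(1)},\dots,x^{(s)})\mapsto\prod_t f_t(x^{(t)})$ (consecutive coordinate blocks in order). For $i+j>n$, $F_2(n,q,i,j)$ is the set of functions $c\cdot\prod_{k=1}^{n-j}g_k\cdot\prod_{k=1}^{i+j-n}h_k\cdot\prod_{k=1}^{j-i}v_k$ with $c$ a real constant, $g_k\in A_1$, $h_k\in A_2$, $v_k\in A_4$. *)

theory Defs
  imports Complex_Main "HOL-Combinatorics.Permutations"
begin

text \<open>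
  A vertex of $H(n,q)$ is a list of length \<open>n\<close> over \<open>{..<q}\<close>, with coordinates numbered from 0.
  A real function on the vertices is a total function on lists of which only the values on
  \<open>words n q\<close> matter: all notions below inspect or constrain it on that set only.
\<close>

definition words :: "nat \<Rightarrow> nat \<Rightarrow> nat list set" where
  "words n q = {x. length x = n \<and> set x \<subseteq> {..<q}}"

definition hamming_adj :: "nat \<Rightarrow> nat \<Rightarrow> nat list \<Rightarrow> nat list \<Rightarrow> bool" where
  "hamming_adj n q x y \<longleftrightarrow>
     x \<in> words n q \<and> y \<in> words n q \<and> card {k. k < n \<and> x ! k \<noteq> y ! k} = 1"

definition eigenfunction :: "nat \<Rightarrow> nat \<Rightarrow> real \<Rightarrow> (nat list \<Rightarrow> real) \<Rightarrow> bool" where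
  "eigenfunction n q l f \<longleftrightarrow>
     (\<forall>x\<in>words n q. l * f x = (\<Sum>y\<in>{y. hamming_adj n q x y}. f y))"

definition hamming_eigenvalue :: "nat \<Rightarrow> nat \<Rightarrow> nat \<Rightarrow> real" where
  "hamming_eigenvalue n q t = real n * (real q - 1) - real q * real t"

definition U :: "nat \<Rightarrow> nat \<Rightarrow> nat \<Rightarrow> (nat list \<Rightarrow> real) set" where
  "U n q t = {f. eigenfunction n q (hamming_eigenvalue n q t) f}"

text \<open>
  The sum of the spaces \<open>U n q t\<close> for \<open>t \<in> {i..j}\<close>. It is automatically direct for \<open>q > 0\<close>, as
  these are eigenspaces of one operator for distinct eigenvalues.
\<close>

definition U_sum :: "nat \<Rightarrow> nat \<Rightarrow> nat \<Rightarrow> nat \<Rightarrow> (nat list \<Rightarrow> real) set" where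
  "U_sum n q i j =
     {f. \<exists>g. (\<forall>t\<in>{i..j}. g t \<in> U n q t) \<and> (\<forall>x\<in>words n q. f x = (\<Sum>t=i..j. g t x))}"

definition supp_size :: "nat \<Rightarrow> nat \<Rightarrow> (nat list \<Rightarrow> real) \<Rightarrow> nat" where
  "supp_size n q f = card {x \<in> words n q. f x \<noteq> 0}"

definition permute_coords :: "nat \<Rightarrow> (nat \<Rightarrow> nat) \<Rightarrow> (nat list \<Rightarrow> real) \<Rightarrow> nat list \<Rightarrow> real" where
  "permute_coords n \<sigma> f = (\<lambda>x. f (map (\<lambda>k. x ! \<sigma> k) [0..<n]))"

definition a1 :: "nat \<Rightarrow> nat \<Rightarrow> nat list \<Rightarrow> real" where
  "a1 k m = (\<lambda>x. if x ! 0 = k \<and> x ! 1 \<noteq> m then 1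
                 else if x ! 1 = m \<and> x ! 0 \<noteq> k then - 1
                 else 0)"

definition a2 :: "nat \<Rightarrow> nat \<Rightarrow> nat list \<Rightarrow> real" where
  "a2 k m = (\<lambda>x. if x ! 0 = k then 1 else if x ! 0 = m then - 1 else 0)"

definition a4 :: "nat \<Rightarrow> nat list \<Rightarrow> real" where
  "a4 m = (\<lambda>x. if x ! 0 = m then 1 else 0)"

definition A1 :: "nat \<Rightarrow> (nat list \<Rightarrow> real) set" where
  "A1 q = {a1 k m | k m. k < q \<and> m < q}"

definition A2 :: "nat \<Rightarrow> (nat list \<Rightarrow> real) set" where
  "A2 q = {a2 k m | k m. k < q \<and> m < q \<and> k \<noteq> m}"

definition A4 :: "nat \<Rightarrow> (nat list \<Rightarrow> real) set" where
  "A4 q = {a4 m | m. m < q}"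

text \<open>
  Each factor is paired with the length of the coordinate block on which it acts.
\<close>

fun block_prod :: "(nat \<times> (nat list \<Rightarrow> real)) list \<Rightarrow> nat list \<Rightarrow> real" where
  "block_prod [] x = 1"
| "block_prod ((m, f) # fs) x = f (take m x) * block_prod fs (drop m x)"

definition F2 :: "nat \<Rightarrow> nat \<Rightarrow> nat \<Rightarrow> nat \<Rightarrow> (nat list \<Rightarrow> real) set" where
  "F2 n q i j = {f. \<exists>c gs hs vs.
     length gs = n - j \<and> set gs \<subseteq> A1 q \<and>
     length hs = i + j - n \<and> set hs \<subseteq> A2 q \<and>
     length vs = j - i \<and> set vs \<subseteq> A4 q \<and>
     (\<forall>x\<in>words n q.
        f x = c * block_prod (map (Pair 2) gs @ map (Pair 1) hs @ map (Pair 1) vs) x)}"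

end

theory Submission
  imports Defs
begin

text \<open>
  Write \<open>s = q - 1\<close>, and let \<open>f_k\<close> be the restriction of \<open>f\<close> to the words with value \<open>k\<close> in
  some fixed coordinate. If \<open>f\<close> lies in the band \<open>[i, j]\<close> of eigenspaces, then \<open>f_k - f_l\<close> lies in the
  band \<open>[i - 1, j - 1]\<close> and the sum of all \<open>f_k\<close> lies in the band \<open>[i, j]\<close>, one dimension lower.

  If some coordinate has two disjoint pairs of letters with \<open>f_k \<noteq> f_l\<close> and \<open>f_k' \<noteq> f_l'\<close>, then
  \<open>|f|\<close> is at least twice the bound for \<open>[i - 1, j - 1]\<close>. Since \<open>q \<ge> 4\<close>, otherwise \<open>f\<close> is uniform:
  in every coordinate all \<open>f_k\<close> but one coincide, say with \<open>g\<close>, the exceptional one being \<open>h\<close>.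
  Then \<open>|f| = (s - 1)|g| + (|g| + |h|)\<close>, where \<open>|g| + |h|\<close> dominates both \<open>|h - g|\<close> and
  \<open>|h + s g|\<close>. This gives \<open>|f| \<ge> (2 s)^(n - j) q^(i + j - n)\<close> for \<open>i + j \<ge> n\<close>, which is stronger than
  required.

  For the equality case with \<open>i = j\<close> and \<open>n < 2 i\<close>, the uniform bound is strict, so two disjoint pairs
  exist and all other \<open>f_m\<close> vanish. As \<open>q \<ge> 5\<close>, some \<open>f_m\<close> does vanish, so all \<open>f_k\<close> lie in the shifted
  band. Exactly two of them are nonzero and they are opposite, which splits off a factor from \<open>A_2\<close>.
  This ends at \<open>n = 2 i\<close>, where \<open>f\<close> must be uniform, and there a count over two coordinates splits off
  factors from \<open>A_1\<close>.
\<close>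

section \<open>Functions on coordinate cubes and spectral bands\<close>

text \<open>Coordinates are labelled by an arbitrary set, so deleting \<open>r\<close> leaves the
  other labels unchanged and inductions over slices need no renumbering. Extensionality makes a
  point determined by its values on \<open>S\<close>.\<close>

definition cube :: "nat \<Rightarrow> nat set \<Rightarrow> (nat \<Rightarrow> nat) set" where
  "cube q S = (S \<rightarrow>\<^sub>E {..<q})"

definition supp_card :: "nat \<Rightarrow> nat set \<Rightarrow> ((nat \<Rightarrow> nat) \<Rightarrow> real) \<Rightarrow> nat" where
  "supp_card q S f = card {x \<in> cube q S. f x \<noteq> 0}"

definition slice :: "nat \<Rightarrow> nat \<Rightarrow> ((nat \<Rightarrow> nat) \<Rightarrow> real) \<Rightarrow> (nat \<Rightarrow> nat) \<Rightarrow> real" where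
  "slice r k f x = f (x(r := k))"

lemma finite_cube: "finite S \<Longrightarrow> finite (cube q S)"
  by (simp add: cube_def finite_PiE)

lemma cube_apply_less: "x \<in> cube q S \<Longrightarrow> r \<in> S \<Longrightarrow> x r < q"
  by (auto simp: cube_def)

lemma cube_upd:
  assumes "x \<in> cube q (S - {r})" "r \<in> S" "k < q"
  shows "x(r := k) \<in> cube q S"
  using assms by (auto simp: cube_def PiE_def extensional_def Pi_def)

lemma cube_split:
  assumes "x \<in> cube q S" "r \<in> S"
  obtains y k where "y \<in> cube q (S - {r})" "k < q" "x = y(r := k)"
proof (rule that[of "x(r := undefined)" "x r"])
  show "x(r := undefined) \<in> cube q (S - {r})"
    using assms by (auto simp: cube_def PiE_def extensional_def Pi_def)
  show "x r < q" using assms by (rule cube_apply_less)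
  show "x = (x(r := undefined))(r := x r)" by (rule ext) simp
qed

lemma cube_eq_image:
  assumes "r \<in> S"
  shows "cube q S = (\<lambda>(k, x). x(r := k)) ` ({..<q} \<times> cube q (S - {r}))"
proof (intro set_eqI iffI)
  fix x assume "x \<in> cube q S"
  then show "x \<in> (\<lambda>(k, x). x(r := k)) ` ({..<q} \<times> cube q (S - {r}))"
    by (rule cube_split[OF _ assms]) (auto simp del: fun_upd_apply)
next
  fix x assume "x \<in> (\<lambda>(k, x). x(r := k)) ` ({..<q} \<times> cube q (S - {r}))"
  then show "x \<in> cube q S" using cube_upd[OF _ assms] by auto
qed

lemma fun_upd_inject_cube:
  assumes "x \<in> cube q (S - {r})" "y \<in> cube q (S - {r})" "x(r := k) = y(r := l)"
  shows "k = l \<and> x = y"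
proof -
  have "x r = undefined" "y r = undefined" using assms by (auto simp: cube_def PiE_def extensional_def)
  moreover have "(x(r := k)) t = (y(r := l)) t" for t using assms(3) by simp
  ultimately show ?thesis by (metis fun_upd_same fun_upd_triv fun_upd_upd assms(3))
qed

lemma supp_card_split:
  assumes "finite S" "r \<in> S"
  shows "supp_card q S f = (\<Sum>k<q. supp_card q (S - {r}) (slice r k f))"
proof -
  let ?A = "\<lambda>k. {x \<in> cube q (S - {r}). slice r k f x \<noteq> 0}"
  have fin: "finite (cube q (S - {r}))" using assms by (simp add: finite_cube)
  have "{x \<in> cube q S. f x \<noteq> 0} = (\<lambda>(k, x). x(r := k)) ` Sigma {..<q} ?A"
    unfolding cube_eq_image[OF assms(2)] slice_def by (auto simp del: fun_upd_apply)
  moreover have "inj_on (\<lambda>(k, x). x(r := k)) (Sigma {..<q} ?A)"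
  proof (rule inj_onI, clarify)
    fix k x l y assume "x \<in> cube q (S - {r})" "y \<in> cube q (S - {r})" "x(r := k) = y(r := l)"
    then show "k = l \<and> x = y" by (rule fun_upd_inject_cube)
  qed
  ultimately have "card {x \<in> cube q S. f x \<noteq> 0} = card (Sigma {..<q} ?A)"
    by (simp add: card_image)
  also have "\<dots> = (\<Sum>k<q. card (?A k))"
    using fin by (intro card_SigmaI) auto
  finally show ?thesis by (simp add: supp_card_def)
qed

lemma supp_card_cong:
  assumes "\<And>x. x \<in> cube q S \<Longrightarrow> f x = 0 \<longleftrightarrow> g x = 0"
  shows "supp_card q S f = supp_card q S g"
  using assms by (auto simp: supp_card_def intro!: arg_cong[where f = card])

lemma supp_card_eq_0_iff:
  "finite S \<Longrightarrow> supp_card q S f = 0 \<longleftrightarrow> (\<forall>x\<in>cube q S. f x = 0)"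
  by (auto simp: supp_card_def finite_cube)

lemma supp_card_le_add:
  assumes "finite S" "\<And>x. x \<in> cube q S \<Longrightarrow> f x = 0 \<Longrightarrow> g x = 0 \<Longrightarrow> u x = 0"
  shows "supp_card q S u \<le> supp_card q S f + supp_card q S g"
proof -
  have "card {x \<in> cube q S. u x \<noteq> 0} \<le> card ({x \<in> cube q S. f x \<noteq> 0} \<union> {x \<in> cube q S. g x \<noteq> 0})"
    using assms by (intro card_mono) (auto simp: finite_cube)
  also have "\<dots> \<le> card {x \<in> cube q S. f x \<noteq> 0} + card {x \<in> cube q S. g x \<noteq> 0}"
    by (rule card_Un_le)
  finally show ?thesis by (simp add: supp_card_def)
qed

text \<open>
  For \<open>card S = n\<close>, the predicate \<open>band q n S a b\<close> stands for the sum of the eigenspaces with index in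
  \<open>[a, n - b]\<close>. Counting the upper end from \<open>n\<close> makes truncated subtraction harmless: restriction
  lowers \<open>a\<close> or \<open>b\<close>, and at \<open>0\<close> the corresponding condition is void. Only the coordinatewise
  consequences of the spectral condition are recorded, as linearity and intersection of bands are then
  immediate.
\<close>

primrec band :: "nat \<Rightarrow> nat \<Rightarrow> nat set \<Rightarrow> nat \<Rightarrow> nat \<Rightarrow> ((nat \<Rightarrow> nat) \<Rightarrow> real) \<Rightarrow> bool" where
  "band q 0 S a b f \<longleftrightarrow> a = 0 \<and> b = 0 \<or> (\<forall>x\<in>cube q S. f x = 0)"
| "band q (Suc n) S a b f \<longleftrightarrow> (\<forall>r\<in>S.
     (\<forall>k<q. \<forall>l<q. band q n (S - {r}) (a - 1) b (\<lambda>x. slice r k f x - slice r l f x)) \<and>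
     band q n (S - {r}) a (b - 1) (\<lambda>x. \<Sum>k<q. slice r k f x))"

lemma band_diffD:
  "band q (Suc n) S a b f \<Longrightarrow> r \<in> S \<Longrightarrow> k < q \<Longrightarrow> l < q \<Longrightarrow>
    band q n (S - {r}) (a - 1) b (\<lambda>x. slice r k f x - slice r l f x)"
  by simp

lemma band_sumD:
  "band q (Suc n) S a b f \<Longrightarrow> r \<in> S \<Longrightarrow> band q n (S - {r}) a (b - 1) (\<lambda>x. \<Sum>k<q. slice r k f x)"
  by simp

section \<open>Closure properties of bands\<close>

lemma band_cong:
  assumes "\<And>x. x \<in> cube q S \<Longrightarrow> f x = g x"
  shows "band q n S a b f \<longleftrightarrow> band q n S a b g"
  using assms
proof (induction n arbitrary: S a b f g)
  case (Suc n)
  have e: "slice r k f x = slice r k g x" if "x \<in> cube q (S - {r})" "r \<in> S" "k < q" for x r k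
    unfolding slice_def using cube_upd[OF that] by (rule Suc.prems)
  have "band q n (S - {r}) (a - 1) b (\<lambda>x. slice r k f x - slice r l f x) \<longleftrightarrow>
        band q n (S - {r}) (a - 1) b (\<lambda>x. slice r k g x - slice r l g x)"
    if "r \<in> S" "k < q" "l < q" for r k l
    using e that by (intro Suc.IH) auto
  moreover have "band q n (S - {r}) a (b - 1) (\<lambda>x. \<Sum>k<q. slice r k f x) \<longleftrightarrow>
        band q n (S - {r}) a (b - 1) (\<lambda>x. \<Sum>k<q. slice r k g x)" if "r \<in> S" for r
    using e that by (intro Suc.IH sum.cong) auto
  ultimately show ?case by simp
qed simp

lemma band_lincomb:
  assumes "band q n S a b f" "band q n S a b g"
  shows "band q n S a b (\<lambda>x. c * f x + d * g x)"
  using assms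
proof (induction n arbitrary: S a b f g)
  case (Suc n)
  have "band q n (S - {r}) (a - 1) b (\<lambda>x. c * slice r k f x + d * slice r k g x -
           (c * slice r l f x + d * slice r l g x))" if "r \<in> S" "k < q" "l < q" for r k l
    using Suc.IH[of "S - {r}" "a - 1" b "\<lambda>x. slice r k f x - slice r l f x"
        "\<lambda>x. slice r k g x - slice r l g x"] Suc.prems that
    by (simp add: algebra_simps)
  moreover have "band q n (S - {r}) a (b - 1) (\<lambda>x. \<Sum>k<q. c * slice r k f x + d * slice r k g x)"
    if "r \<in> S" for r
    using Suc.IH[of "S - {r}" a "b - 1" "\<lambda>x. \<Sum>k<q. slice r k f x"
        "\<lambda>x. \<Sum>k<q. slice r k g x"] Suc.prems that
    by (simp add: sum.distrib sum_distrib_left)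
  ultimately show ?case by (simp add: slice_def)
qed auto

lemma band_scale: "band q n S a b f \<Longrightarrow> band q n S a b (\<lambda>x. c * f x)"
  using band_lincomb[of q n S a b f f c 0] by simp

lemma band_scale_iff:
  assumes "c \<noteq> 0" shows "band q n S a b (\<lambda>x. c * f x) \<longleftrightarrow> band q n S a b f"
  using band_scale[of q n S a b f c] band_scale[of q n S a b "\<lambda>x. c * f x" "1 / c"] assms by auto

lemma band_zero: "band q n S a b (\<lambda>x. 0)"
  by (induction n arbitrary: S a b) (auto simp: slice_def)

lemma band_sum:
  assumes "finite T" "\<And>t. t \<in> T \<Longrightarrow> band q n S a b (f t)"
  shows "band q n S a b (\<lambda>x. \<Sum>t\<in>T. f t x)"
  using assms
proof (induction T rule: finite_induct)
  case (insert t T)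
  then show ?case using band_lincomb[of q n S a b "f t" "\<lambda>x. \<Sum>t\<in>T. f t x" 1 1] by simp
qed (simp add: band_zero)

lemma band_mono: "band q n S a b f \<Longrightarrow> a' \<le> a \<Longrightarrow> b' \<le> b \<Longrightarrow> band q n S a' b' f"
proof (induction n arbitrary: S a b a' b' f)
  case (Suc n)
  have le: "a' - 1 \<le> a - 1" "b' - 1 \<le> b - 1" using Suc.prems by auto
  show ?case unfolding band.simps
  proof (intro ballI conjI allI impI)
    fix r k l assume "r \<in> S" "k < q" "l < q"
    then have "band q n (S - {r}) (a - 1) b (\<lambda>x. slice r k f x - slice r l f x)"
      using Suc.prems by simp
    then show "band q n (S - {r}) (a' - 1) b' (\<lambda>x. slice r k f x - slice r l f x)"
      using le(1) Suc.prems(3) by (rule Suc.IH)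
  next
    fix r assume "r \<in> S"
    then have "band q n (S - {r}) a (b - 1) (\<lambda>x. \<Sum>k<q. slice r k f x)"
      using Suc.prems by simp
    then show "band q n (S - {r}) a' (b' - 1) (\<lambda>x. \<Sum>k<q. slice r k f x)"
      using Suc.prems(2) le(2) by (rule Suc.IH)
  qed
qed auto

lemma band_max:
  "band q n S a b f \<Longrightarrow> band q n S a' b' f \<Longrightarrow> band q n S (max a a') (max b b') f"
proof (induction n arbitrary: S a b a' b' f)
  case (Suc n)
  have *: "max a a' - 1 = max (a - 1) (a' - 1)" "max b b' - 1 = max (b - 1) (b' - 1)" by auto
  show ?case unfolding band.simps *
  proof (intro ballI conjI allI impI)
    fix r k l assume "r \<in> S" "k < q" "l < q"
    then show "band q n (S - {r}) (max (a - 1) (a' - 1)) (max b b')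
        (\<lambda>x. slice r k f x - slice r l f x)"
      using Suc.prems by (intro Suc.IH) auto
  next
    fix r assume "r \<in> S"
    then show "band q n (S - {r}) (max a a') (max (b - 1) (b' - 1)) (\<lambda>x. \<Sum>k<q. slice r k f x)"
      using Suc.prems by (intro Suc.IH) auto
  qed
qed auto

text \<open>Meant for a function that arises both from differences of slices and from the sum of all
  slices: the loss of one in \<open>a\<close> and the loss of one in \<open>b\<close> then
  compensate each other.\<close>

lemma band_join:
  assumes "band q n S (a - 1) b f" "band q n S a (b - 1) f"
  shows "band q n S a b f"
  using band_max[OF assms] by (simp add: max_absorb1 max_absorb2)

text \<open>For \<open>n < a + b\<close> the index interval [a, n - b] is empty. In one coordinate
  the differences of slices vanish by induction, so all slices agree; their sum vanishes as well,
  and it is \<open>q\<close> times each of them.\<close>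

lemma band_eq_0:
  assumes "band q n S a b f" "card S = n" "finite S" "n < a + b" "x \<in> cube q S"
  shows "f x = 0"
  using assms
proof (induction n arbitrary: S a b f x)
  case (Suc n)
  then obtain r where r: "r \<in> S" by fastforce
  obtain y m where y: "y \<in> cube q (S - {r})" "m < q" "x = y(r := m)"
    using cube_split[OF Suc.prems(5) r] by metis
  have c: "card (S - {r}) = n" "finite (S - {r})" using Suc.prems r by auto
  have lt: "n < (a - 1) + b" "n < a + (b - 1)" using Suc.prems(4) by auto
  have eq: "slice r k f y = slice r m f y" if "k < q" for k
    using Suc.IH[OF band_diffD[OF Suc.prems(1) r that y(2)] c lt(1) y(1)] by simp
  have "(\<Sum>k<q. slice r k f y) = 0"
    using Suc.IH[OF band_sumD[OF Suc.prems(1) r] c lt(2) y(1)] by simp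
  then have "real q * slice r m f y = 0" using eq by simp
  then show ?case unfolding y(3) using y(2) by (simp add: slice_def del: fun_upd_apply)
qed auto

text \<open>By q f_k = sum_l (f_k - f_l) + sum_l f_l: the differences cost one in \<open>a\<close>,
  the sum costs one in \<open>b\<close>.\<close>

lemma band_slice:
  assumes "band q (Suc n) S a b f" "r \<in> S" "k < q"
  shows "band q n (S - {r}) (a - 1) (b - 1) (slice r k f)"
proof -
  have 1: "band q n (S - {r}) (a - 1) (b - 1) (\<lambda>x. \<Sum>l<q. slice r k f x - slice r l f x)"
  proof (rule band_sum)
    fix l assume "l \<in> {..<q}"
    then have "band q n (S - {r}) (a - 1) b (\<lambda>x. slice r k f x - slice r l f x)"
      using band_diffD[OF assms] by simp
    then show "band q n (S - {r}) (a - 1) (b - 1) (\<lambda>x. slice r k f x - slice r l f x)"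
      by (rule band_mono) auto
  qed simp
  have 2: "band q n (S - {r}) (a - 1) (b - 1) (\<lambda>x. \<Sum>l<q. slice r l f x)"
    using band_sumD[OF assms(1,2)] by (rule band_mono) auto
  have "band q n (S - {r}) (a - 1) (b - 1) (\<lambda>x. real q * slice r k f x)"
    using band_lincomb[OF 1 2, of 1 1] by (simp add: sum_subtractf)
  then show ?thesis using assms(3) by (subst (asm) band_scale_iff) auto
qed

section \<open>Uniform functions\<close>

lemma slice_commute: "r \<noteq> t \<Longrightarrow> slice r k (slice t l f) = slice t l (slice r k f)"
  by (simp add: slice_def fun_eq_iff fun_upd_twist)

text \<open>\<open>\<mu> r\<close> is the exceptional letter of coordinate \<open>r\<close>; its
  slice may also agree with the others. With \<open>\<mu>\<close> as a parameter, a function, its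
  slices and their linear combinations share the same exceptional letters.\<close>

definition uniform :: "nat \<Rightarrow> nat set \<Rightarrow> (nat \<Rightarrow> nat) \<Rightarrow> ((nat \<Rightarrow> nat) \<Rightarrow> real) \<Rightarrow> bool" where
  "uniform q S \<mu> f \<longleftrightarrow> (\<forall>r\<in>S. \<mu> r < q \<and> (\<forall>k<q. \<forall>l<q. k \<noteq> \<mu> r \<longrightarrow> l \<noteq> \<mu> r \<longrightarrow>
     (\<forall>x\<in>cube q (S - {r}). slice r k f x = slice r l f x)))"

lemma uniformD:
  assumes "uniform q S \<mu> f" "r \<in> S"
  shows "\<mu> r < q"
    and "k < q \<Longrightarrow> l < q \<Longrightarrow> k \<noteq> \<mu> r \<Longrightarrow> l \<noteq> \<mu> r \<Longrightarrow> x \<in> cube q (S - {r}) \<Longrightarrow>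
      slice r k f x = slice r l f x"
  using assms unfolding uniform_def by blast+

lemma uniform_lincomb:
  assumes "uniform q S \<mu> f" "uniform q S \<mu> g"
  shows "uniform q S \<mu> (\<lambda>x. c * f x + d * g x)"
  unfolding uniform_def
proof (intro ballI conjI allI impI)
  fix r k l x
  assume "r \<in> S" "k < q" "l < q" "k \<noteq> \<mu> r" "l \<noteq> \<mu> r" "x \<in> cube q (S - {r})"
  then show "slice r k (\<lambda>x. c * f x + d * g x) x = slice r l (\<lambda>x. c * f x + d * g x) x"
    using uniformD(2)[OF assms(1), of r k l x] uniformD(2)[OF assms(2), of r k l x]
    by (simp add: slice_def)
qed (rule uniformD(1)[OF assms(1)])

lemma uniform_slice:
  assumes "uniform q S \<mu> f" "r \<in> S" "m < q"
  shows "uniform q (S - {r}) \<mu> (slice r m f)"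
  unfolding uniform_def
proof (intro ballI conjI allI impI)
  fix t k l x
  assume t: "t \<in> S - {r}" and kl: "k < q" "l < q" "k \<noteq> \<mu> t" "l \<noteq> \<mu> t"
    and x: "x \<in> cube q (S - {r} - {t})"
  have "S - {r} - {t} = S - {t} - {r}" by blast
  then have "slice r m (slice t k f) x = slice r m (slice t l f) x"
    using uniformD(2)[OF assms(1) _ kl] cube_upd[of x q "S - {t}" r m] t x assms
    unfolding slice_def[of r m] by simp
  then show "slice t k (slice r m f) x = slice t l (slice r m f) x"
    using t by (simp add: slice_commute[of t r])
qed (use uniformD(1)[OF assms(1)] in auto)

lemma uniform_supp_card_split:
  assumes "uniform q S \<mu> f" "finite S" "r \<in> S" "m < q" "m \<noteq> \<mu> r"
  shows "supp_card q S f =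
    (q - 1) * supp_card q (S - {r}) (slice r m f) + supp_card q (S - {r}) (slice r (\<mu> r) f)"
proof -
  have \<mu>: "\<mu> r < q" using uniformD(1)[OF assms(1,3)] .
  have "supp_card q (S - {r}) (slice r k f) = supp_card q (S - {r}) (slice r m f)"
    if "k \<in> {..<q} - {\<mu> r}" for k
    using uniformD(2)[OF assms(1,3), of k m] that assms(4,5) by (intro supp_card_cong) simp
  then have "(\<Sum>k\<in>{..<q} - {\<mu> r}. supp_card q (S - {r}) (slice r k f)) =
      (q - 1) * supp_card q (S - {r}) (slice r m f)"
    using \<mu> by simp
  then show ?thesis
    using \<mu> by (simp add: supp_card_split[OF assms(2,3)] sum.remove[of "{..<q}" "\<mu> r"])
qed

lemma uniform_sum_slices:
  assumes "uniform q S \<mu> f" "r \<in> S" "m < q" "m \<noteq> \<mu> r" "x \<in> cube q (S - {r})"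
  shows "(\<Sum>k<q. slice r k f x) = slice r (\<mu> r) f x + (real q - 1) * slice r m f x"
proof -
  have \<mu>: "\<mu> r < q" using uniformD(1)[OF assms(1,2)] .
  have "slice r k f x = slice r m f x" if "k \<in> {..<q} - {\<mu> r}" for k
    using uniformD(2)[OF assms(1,2) _ assms(3) _ assms(4,5), of k] that by simp
  then have "(\<Sum>k\<in>{..<q} - {\<mu> r}. slice r k f x) = (\<Sum>k\<in>{..<q} - {\<mu> r}. slice r m f x)"
    by (intro sum.cong) auto
  then show ?thesis
    using \<mu> by (simp add: sum.remove[of "{..<q}" "\<mu> r"] of_nat_diff)
qed

text \<open>The second exponent is |a - b|, written with truncated subtraction. By symmetry, the
  estimates for lowering \<open>a\<close> follow from those for lowering \<open>b\<close>.\<close>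

definition uniform_bound :: "nat \<Rightarrow> nat \<Rightarrow> nat \<Rightarrow> nat" where
  "uniform_bound q a b = (2 * (q - 1)) ^ min a b * q ^ ((a - b) + (b - a))"

lemma uniform_bound_commute: "uniform_bound q a b = uniform_bound q b a"
  by (simp add: uniform_bound_def min.commute add.commute)

lemma uniform_bound_Suc_Suc: "uniform_bound q (Suc a) (Suc b) = 2 * (q - 1) * uniform_bound q a b"
  by (simp add: uniform_bound_def)

lemma uniform_bound_Suc: "a \<le> b \<Longrightarrow> uniform_bound q a (Suc b) = q * uniform_bound q a b"
  by (simp add: uniform_bound_def Suc_diff_le)

text \<open>Lowering \<open>b\<close> removes a factor \<open>q\<close> if \<open>a < b\<close>.
  Otherwise, for positive \<open>b\<close>, it replaces a factor 2 (q - 1) by \<open>q\<close>, and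
  2 (q - 1) <= q * q.\<close>

lemma uniform_bound_le_pred:
  assumes "2 \<le> q"
  shows "uniform_bound q a b \<le> q * uniform_bound q a (b - 1)"
proof (cases "a < b")
  case True
  then show ?thesis using uniform_bound_Suc[of a "b - 1" q] by simp
next
  case False
  show ?thesis
  proof (cases b)
    case 0 then show ?thesis using assms by simp
  next
    case (Suc c)
    with False obtain d where a: "a = Suc d" "c \<le> d" by (cases a) auto
    have "uniform_bound q a b = 2 * (q - 1) * uniform_bound q d c"
      by (simp add: a Suc uniform_bound_Suc_Suc)
    also have "\<dots> \<le> q * q * uniform_bound q d c"
      using assms by (intro mult_right_mono mult_mono) auto
    also have "\<dots> = q * uniform_bound q a (b - 1)"
      using uniform_bound_Suc[OF a(2), of q] by (simp add: a Suc uniform_bound_commute)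
    finally show ?thesis .
  qed
qed

text \<open>In the generic case with positive \<open>a\<close> and \<open>b\<close>, one of the
  inductive bounds for the difference and the sum is \<open>q\<close> times the bound for
  \<open>a - 1\<close>, \<open>b - 1\<close>. Together with the q - 2 further copies of
  \<open>g\<close> this gives the new factor q + (q - 2) = 2 (q - 1). In the degenerate cases a
  single function carries the whole support.\<close>

lemma uniform_bound_le_supp_card:
  assumes "2 \<le> q" "finite S" "card S = n" "band q n S a b f" "uniform q S \<mu> f"
    "supp_card q S f \<noteq> 0"
  shows "uniform_bound q a b \<le> supp_card q S f"
  using assms(2-)
proof (induction n arbitrary: S a b f)
  case 0
  then have "a = 0" "b = 0" by (auto simp: supp_card_eq_0_iff)
  then show ?case using "0.prems" by (simp add: uniform_bound_def)
next
  case (Suc n)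
  then obtain r where r: "r \<in> S" by fastforce
  define T where "T = S - {r}"
  have T: "finite T" "card T = n" using Suc.prems r by (auto simp: T_def)
  have \<mu>: "\<mu> r < q" using uniformD(1)[OF Suc.prems(4) r] .
  define m where "m = (if \<mu> r = 0 then 1 else 0 :: nat)"
  have m: "m < q" "m \<noteq> \<mu> r" using assms(1) by (auto simp: m_def)
  define g h where "g = slice r m f" and "h = slice r (\<mu> r) f"
  define G H where "G = supp_card q T g" and "H = supp_card q T h"
  note IH = Suc.IH[OF T]
  \<comment> \<open>\<open>p\<close> stands for q - 2, the number of ordinary slices left after one
    of them is grouped with \<open>h\<close>.\<close>
  obtain p where p: "q = Suc (Suc p)" using assms(1) by (metis add_2_eq_Suc le_Suc_ex)
  have "supp_card q S f = (q - 1) * G + H"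
    using uniform_supp_card_split[OF Suc.prems(4,1) r m] by (simp add: G_def H_def g_def h_def T_def)
  moreover have "(q - 1) * G = p * G + G" "q * G = p * G + G + G" by (simp_all add: p)
  ultimately have supp: "supp_card q S f = p * G + (G + H)" and qG: "q * G = p * G + G + G" by simp_all
  have ug: "uniform q T \<mu> g" and uh: "uniform q T \<mu> h"
    using uniform_slice[OF Suc.prems(4) r] m \<mu> by (auto simp: g_def h_def T_def)
  have bg: "band q n T (a - 1) (b - 1) g"
    using band_slice[OF Suc.prems(3) r m(1)] by (simp add: g_def T_def)
  have bd: "band q n T (a - 1) b (\<lambda>x. h x - g x)"
    using band_diffD[OF Suc.prems(3) r \<mu> m(1)] by (simp add: g_def h_def T_def)
  have bs: "band q n T a (b - 1) (\<lambda>x. h x + (real q - 1) * g x)"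
    using band_sumD[OF Suc.prems(3) r] uniform_sum_slices[OF Suc.prems(4) r m]
    unfolding g_def h_def T_def by (simp cong: band_cong)
  have zero: "x \<in> cube q T \<Longrightarrow> u x = 0" if "supp_card q T u = 0" for u x
    using that T by (simp add: supp_card_eq_0_iff)
  \<comment> \<open>The induction hypothesis speaks of nonzero functions only, so the cases in which
    \<open>g\<close>, \<open>h\<close>, their difference or the sum of slices vanishes are treated
    first.\<close>
  consider "G = 0" | "H = 0" "G \<noteq> 0" | "supp_card q T (\<lambda>x. h x - g x) = 0" "G \<noteq> 0"
    | "supp_card q T (\<lambda>x. h x + (real q - 1) * g x) = 0" "G \<noteq> 0"
    | "supp_card q T (\<lambda>x. h x - g x) \<noteq> 0" "supp_card q T (\<lambda>x. h x + (real q - 1) * g x) \<noteq> 0" "G \<noteq> 0"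
    by blast
  then show ?case
  proof cases
    case 1
    \<comment> \<open>Difference and sum both reduce to \<open>h\<close>, which therefore keeps the
      full band.\<close>
    then have z: "\<And>x. x \<in> cube q T \<Longrightarrow> g x = 0" using zero G_def by simp
    have "band q n T (a - 1) b h" "band q n T a (b - 1) h"
      using bd bs z by (simp_all cong: band_cong)
    then have "band q n T a b h" by (rule band_join)
    moreover have "H \<noteq> 0" using Suc.prems(5) 1 by (simp add: supp)
    ultimately show ?thesis using IH[of a b h] uh 1 by (simp add: supp H_def)
  next
    case 2
    then have z: "\<And>x. x \<in> cube q T \<Longrightarrow> h x = 0" using zero H_def by simp
    have "band q n T (a - 1) b (\<lambda>x. (- 1) * g x)" "band q n T a (b - 1) (\<lambda>x. (real q - 1) * g x)"
      using bd bs z by (simp_all cong: band_cong)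
    then have "band q n T (a - 1) b g" "band q n T a (b - 1) g"
      using assms(1) by (subst (asm) band_scale_iff; simp)+
    then have "band q n T a b g" by (rule band_join)
    from IH[OF this ug] 2 have "uniform_bound q a b \<le> G" by (simp add: G_def)
    then show ?thesis by (simp add: supp)
  next
    case 3
    \<comment> \<open>Now \<open>f\<close> does not depend on coordinate \<open>r\<close>. The sum
      of slices is \<open>q\<close> times \<open>g\<close>, which yields only \<open>a\<close>,
      \<open>b - 1\<close>, but the support of \<open>f\<close> is \<open>q\<close> times that of
      \<open>g\<close>.\<close>
    have z: "h x = g x" if "x \<in> cube q T" for x using zero[OF 3(1) that] by simp
    then have "band q n T a (b - 1) (\<lambda>x. real q * g x)"
      using bs by (simp add: algebra_simps cong: band_cong)
    then have "band q n T a (b - 1) g" using assms(1) by (subst (asm) band_scale_iff; simp)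
    from IH[OF this ug] 3 have "uniform_bound q a (b - 1) \<le> G" by (simp add: G_def)
    then have "uniform_bound q a b \<le> q * G"
      using uniform_bound_le_pred[OF assms(1), of a b] by (meson le_trans mult_le_mono2)
    moreover have "H = G" using z by (auto simp: G_def H_def intro: supp_card_cong)
    ultimately show ?thesis by (simp add: supp qG)
  next
    case 4
    \<comment> \<open>The dual situation: the slices sum to zero and the difference is
      \<open>- q\<close> times \<open>g\<close>, so \<open>b\<close> is kept and \<open>a\<close>
      drops. Again \<open>g\<close> and \<open>h\<close> have supports of the same size.\<close>
    then have z: "h x = - ((real q - 1) * g x)" if "x \<in> cube q T" for x
      using zero[OF 4(1) that] by simp
    have "band q n T (a - 1) b (\<lambda>x. (- real q) * g x)"
      by (rule band_cong[THEN iffD1, OF _ bd]) (simp add: z algebra_simps)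
    then have "band q n T (a - 1) b g" using assms(1) by (subst (asm) band_scale_iff; simp)
    from IH[OF this ug] 4 have "uniform_bound q (a - 1) b \<le> G" by (simp add: G_def)
    then have "uniform_bound q a b \<le> q * G"
      using uniform_bound_le_pred[OF assms(1), of b a]
      by (metis le_trans mult_le_mono2 uniform_bound_commute)
    moreover have "H = G" using z assms(1) by (auto simp: G_def H_def intro: supp_card_cong)
    ultimately show ?thesis by (simp add: supp qG)
  next
    case 5
    have "uniform_bound q (a - 1) b \<le> supp_card q T (\<lambda>x. h x - g x)"
      using IH[OF bd _ 5(1)] uniform_lincomb[OF uh ug, of 1 "- 1"] by simp
    also have "\<dots> \<le> G + H" using T(1) unfolding G_def H_def by (rule supp_card_le_add) simp
    finally have D: "uniform_bound q (a - 1) b \<le> G + H" .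
    have "uniform_bound q a (b - 1) \<le> supp_card q T (\<lambda>x. h x + (real q - 1) * g x)"
      using IH[OF bs _ 5(2)] uniform_lincomb[OF uh ug, of 1 "real q - 1"] by simp
    also have "\<dots> \<le> G + H" using T(1) unfolding G_def H_def by (rule supp_card_le_add) simp
    finally have E: "uniform_bound q a (b - 1) \<le> G + H" .
    have G: "uniform_bound q (a - 1) (b - 1) \<le> G" using IH[OF bg ug] 5 by (simp add: G_def)
    show ?thesis
    \<comment> \<open>At 0 truncated subtraction changes nothing, so \<open>D\<close> or
      \<open>E\<close> is already the desired bound.\<close>
    proof (cases "a = 0 \<or> b = 0")
      case True
      then have "uniform_bound q a b \<le> G + H" using D E by auto
      then show ?thesis by (simp add: supp qG)
    next
      case False
      then obtain c d where cd: "a = Suc c" "b = Suc d" by (meson not0_implies_Suc)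
      \<comment> \<open>The estimate that keeps the larger of the two indices gains the factor
        \<open>q\<close>.\<close>
      have "q * uniform_bound q c d \<le> G + H"
      proof (cases "c \<le> d")
        case True
        then show ?thesis using D by (simp add: cd uniform_bound_Suc)
      next
        case False
        then show ?thesis using E uniform_bound_Suc[of d c q]
          by (simp add: cd uniform_bound_commute)
      qed
      moreover have "p * uniform_bound q c d \<le> p * G" using G by (simp add: cd)
      moreover have "uniform_bound q a b = q * uniform_bound q c d + p * uniform_bound q c d"
        by (simp add: cd uniform_bound_Suc_Suc) (simp add: p algebra_simps)
      ultimately show ?thesis unfolding supp by linarith
    qed
  qed
qed

section \<open>The lower bound\<close>

text \<open>Start from one pair \<open>k\<close>, \<open>l\<close> with different values. If
  \<open>v\<close> is not constant on the remaining letters, a second pair lies there. If it is,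
  either both \<open>v k\<close> and \<open>v l\<close> differ from that constant, and each can be
  paired with its own remaining letter, of which there are at least two, or only one letter is
  exceptional.\<close>

lemma near_constant_or_two_pairs:
  fixes q :: nat
  assumes "4 \<le> q"
  obtains (near) m where "m < q" "\<And>k l. k < q \<Longrightarrow> l < q \<Longrightarrow> k \<noteq> m \<Longrightarrow> l \<noteq> m \<Longrightarrow> v k = v l"
  | (pairs) k l k' l' where "k < q" "l < q" "k' < q" "l' < q" "distinct [k, l, k', l']"
      "v k \<noteq> v l" "v k' \<noteq> v l'"
proof (cases "\<exists>k<q. \<exists>l<q. v k \<noteq> v l")
  case False
  have "0 < q" using assms by simp
  then show thesis by (rule near) (use False in blast)
next
  case True
  then obtain k l where kl: "k < q" "l < q" "v k \<noteq> v l" by blast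
  have "card ({..<q} - {k, l}) \<ge> 2"
    using kl assms by (cases "k = l") (auto simp: card_Diff_subset)
  then obtain x y where xy: "x \<in> {..<q} - {k, l}" "y \<in> {..<q} - {k, l}" "x \<noteq> y"
    using card_le_Suc0_iff_eq[of "{..<q} - {k, l}"] by auto
  show thesis
  proof (cases "\<forall>z\<in>{..<q} - {k, l}. v z = v x")
    case False
    then obtain z where "z \<in> {..<q} - {k, l}" "v z \<noteq> v x" by blast
    then show thesis using pairs[of k l z x] kl xy by auto
  next
    case True
    then have c: "v z = v x" if "z < q" "z \<noteq> k" "z \<noteq> l" for z using that by auto
    show thesis
    proof (cases "v k = v x \<or> v l = v x")
      case False
      then show thesis using pairs[of k x l y] kl xy c[of y] by auto
    next
      case True
      then show thesis
      proof
        assume "v k = v x"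
        then have "v z = v x" if "z < q" "z \<noteq> l" for z using c[of z] that by (cases "z = k") auto
        then show thesis by (intro near[OF kl(2)]) simp
      next
        assume "v l = v x"
        then have "v z = v x" if "z < q" "z \<noteq> k" for z using c[of z] that by (cases "z = l") auto
        then show thesis by (intro near[OF kl(1)]) simp
      qed
    qed
  qed
qed

lemma not_uniform_two_pairs:
  assumes "4 \<le> q" "\<And>\<mu>. \<not> uniform q S \<mu> f"
  obtains r k l k' l' where "r \<in> S" "k < q" "l < q" "k' < q" "l' < q" "distinct [k, l, k', l']"
    "\<exists>x\<in>cube q (S - {r}). slice r k f x \<noteq> slice r l f x"
    "\<exists>x\<in>cube q (S - {r}). slice r k' f x \<noteq> slice r l' f x"
proof -
  \<comment> \<open>Restriction to the cube turns agreement on all relevant points into equality, so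
    the dichotomy applies with slices as values.\<close>
  define v where "v r k = restrict (slice r k f) (cube q (S - {r}))" for r k
  have v: "v r k = v r l \<longleftrightarrow> (\<forall>x\<in>cube q (S - {r}). slice r k f x = slice r l f x)" for r k l
    by (auto simp: v_def fun_eq_iff restrict_def)
  define P where "P r m \<longleftrightarrow> (\<forall>k<q. \<forall>l<q. k \<noteq> m \<longrightarrow> l \<noteq> m \<longrightarrow> v r k = v r l)" for r m
  have "\<exists>r\<in>S. \<forall>m<q. \<not> P r m"
  proof (rule ccontr)
    assume "\<not> (\<exists>r\<in>S. \<forall>m<q. \<not> P r m)"
    then have "\<forall>r\<in>S. \<exists>m. m < q \<and> P r m" by blast
    from bchoice[OF this] obtain \<mu> where "\<forall>r\<in>S. \<mu> r < q \<and> P r (\<mu> r)" ..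
    then have "uniform q S \<mu> f" unfolding uniform_def P_def v .
    then show False using assms(2) by blast
  qed
  then obtain r where r: "r \<in> S" "\<And>m. m < q \<Longrightarrow> \<not> P r m" by blast
  from assms(1) show thesis
  proof (cases rule: near_constant_or_two_pairs[of q "v r"])
    case (near m)
    then show thesis using r(2)[OF near(1)] unfolding P_def by blast
  next
    case (pairs k l k' l')
    then show thesis using that[OF r(1) pairs(1-5)] unfolding v by blast
  qed
qed

text \<open>The branches agree at \<open>a = b\<close>. The first equals
  \<open>uniform_bound\<close>; the second arises from it by replacing each of the a - b factors
  \<open>q\<close> by 2. The first is needed because the induction lowers \<open>a\<close> below
  \<open>b\<close>.\<close>

definition band_bound :: "nat \<Rightarrow> nat \<Rightarrow> nat \<Rightarrow> nat" where
  "band_bound q a b = (if a \<le> b then (2 * (q - 1)) ^ a * q ^ (b - a) else 2 ^ a * (q - 1) ^ b)"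

lemma band_bound_le_uniform_bound:
  assumes "2 \<le> q"
  shows "band_bound q a b \<le> uniform_bound q a b"
proof (cases "a \<le> b")
  case True
  then show ?thesis by (simp add: band_bound_def uniform_bound_def min_def)
next
  case False
  then have "(2::nat) ^ a = 2 ^ b * 2 ^ (a - b)" by (simp flip: power_add)
  then have "band_bound q a b = (2 * (q - 1)) ^ b * 2 ^ (a - b)"
    using False by (simp add: band_bound_def power_mult_distrib)
  also have "\<dots> \<le> (2 * (q - 1)) ^ b * q ^ (a - b)"
    using assms by (intro mult_left_mono power_mono) auto
  finally show ?thesis using False by (simp add: uniform_bound_def min_def)
qed

text \<open>Strict because at least one factor \<open>q\<close> is replaced by 2. This excludes
  uniform functions from the equality case with \<open>b < a\<close>.\<close>

lemma band_bound_less_uniform_bound: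
  assumes "3 \<le> q" "b < a"
  shows "band_bound q a b < uniform_bound q a b"
proof -
  have "(2::nat) ^ a = 2 ^ b * 2 ^ (a - b)" using assms by (simp flip: power_add)
  then have "band_bound q a b = (2 * (q - 1)) ^ b * 2 ^ (a - b)"
    using assms by (simp add: band_bound_def power_mult_distrib)
  also have "\<dots> < (2 * (q - 1)) ^ b * q ^ (a - b)"
    using assms by (intro mult_strict_left_mono power_strict_mono) auto
  finally show ?thesis using assms by (simp add: uniform_bound_def min_def)
qed

text \<open>The two sides have quotient (q - 1) / q. The strictness excludes two disjoint pairs from
  the equality case with \<open>a = b\<close>.\<close>

lemma band_bound_less_twice_pred:
  assumes "2 \<le> q" "a \<le> b" "a \<noteq> 0"
  shows "band_bound q a b < 2 * band_bound q (a - 1) b"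
proof -
  obtain c where c: "a = Suc c" using assms(3) by (cases a) auto
  have "b - c = Suc (b - a)" using assms c by simp
  moreover have "(2 * (q - 1)) ^ c * q ^ (b - a) * (q - 1) < (2 * (q - 1)) ^ c * q ^ (b - a) * q"
    using assms by (intro mult_strict_left_mono) auto
  ultimately show ?thesis using assms by (simp add: band_bound_def c mult_ac)
qed

text \<open>Exact doubling: two disjoint pairs of distinct slices already use up a minimum support,
  which forces all other slices of a minimal function to vanish.\<close>

lemma band_bound_twice_pred:
  assumes "b < a"
  shows "band_bound q a b = 2 * band_bound q (a - 1) b"
proof -
  obtain c where c: "a = Suc c" using assms by (cases a) auto
  then show ?thesis
    using assms by (cases "c = b") (auto simp: band_bound_def power_mult_distrib)
qed

lemma sum_two_pairs:
  fixes w :: "nat \<Rightarrow> nat"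
  assumes "k < q" "l < q" "k' < q" "l' < q" "distinct [k, l, k', l']"
  shows "(\<Sum>m<q. w m) = (w k + w l) + (w k' + w l') + (\<Sum>m\<in>{..<q} - {k, l, k', l'}. w m)"
proof -
  have "(\<Sum>m<q. w m) = (\<Sum>m\<in>{..<q} - {k, l, k', l'}. w m) + (\<Sum>m\<in>{k, l, k', l'}. w m)"
    using assms by (intro sum.subset_diff) auto
  then show ?thesis using assms(5) by simp
qed

lemma supp_card_diff_le:
  assumes "finite S"
  shows "supp_card q S (\<lambda>x. f x - g x) \<le> supp_card q S f + supp_card q S g"
  using assms by (rule supp_card_le_add) simp

text \<open>If \<open>f\<close> is not uniform, two nonzero differences of slices on four distinct
  letters each obey the bound for \<open>a - 1\<close>, \<open>b\<close>, and each is paid for by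
  its own two slices.\<close>

lemma band_bound_le_supp_card:
  assumes "4 \<le> q" "finite S" "card S = n" "band q n S a b f" "supp_card q S f \<noteq> 0"
  shows "band_bound q a b \<le> supp_card q S f"
  using assms(2-)
proof (induction n arbitrary: S a b f)
  case 0
  then have "a = 0" "b = 0" by (auto simp: supp_card_eq_0_iff)
  then show ?case using "0.prems" by (simp add: band_bound_def)
next
  case (Suc n)
  show ?case
  proof (cases "\<exists>\<mu>. uniform q S \<mu> f")
    case True
    then obtain \<mu> where "uniform q S \<mu> f" ..
    then have "uniform_bound q a b \<le> supp_card q S f"
      using uniform_bound_le_supp_card[of q S "Suc n" a b f \<mu>] Suc.prems assms(1) by simp
    then show ?thesis using band_bound_le_uniform_bound[of q a b] assms(1) by simp
  next
    case False
    obtain r k l k' l' where r: "r \<in> S" and kl: "k < q" "l < q" "k' < q" "l' < q" "distinct [k, l, k', l']"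
      and ne: "\<exists>x\<in>cube q (S - {r}). slice r k f x \<noteq> slice r l f x"
       "\<exists>x\<in>cube q (S - {r}). slice r k' f x \<noteq> slice r l' f x"
      using not_uniform_two_pairs[OF assms(1), of S f] False by blast
    let ?w = "\<lambda>m. supp_card q (S - {r}) (slice r m f)"
    have T: "finite (S - {r})" "card (S - {r}) = n" using Suc.prems r by auto
    have pair: "band_bound q (a - 1) b \<le> ?w k + ?w l"
      if "k < q" "l < q" "\<exists>x\<in>cube q (S - {r}). slice r k f x \<noteq> slice r l f x" for k l
    proof -
      have "band_bound q (a - 1) b \<le> supp_card q (S - {r}) (\<lambda>x. slice r k f x - slice r l f x)"
        using band_diffD[OF Suc.prems(3) r that(1,2)] that(3) T
        by (intro Suc.IH) (auto simp: supp_card_eq_0_iff)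
      also have "\<dots> \<le> ?w k + ?w l" using T(1) by (rule supp_card_diff_le)
      finally show ?thesis .
    qed
    have "2 * band_bound q (a - 1) b \<le> supp_card q S f"
      using pair[OF kl(1,2) ne(1)] pair[OF kl(3,4) ne(2)] sum_two_pairs[OF kl, of ?w]
      by (simp add: supp_card_split[OF Suc.prems(1) r])
    moreover have "band_bound q a b \<le> 2 * band_bound q (a - 1) b"
      \<comment> \<open>For \<open>a = 0\<close> both sides contain the same bound, as 0 - 1 is
        0.\<close>
      using band_bound_less_twice_pred[of q a b] band_bound_twice_pred[of b a q] assms(1)
      by (cases "a = 0"; cases "a \<le> b") auto
    ultimately show ?thesis by simp
  qed
qed

section \<open>Uniform functions of minimum support\<close>

text \<open>
  The coordinates in \<open>R\<close> carry factors from \<open>A_4\<close>; they occur in the induction although they are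
  absent from the final result.
\<close>

definition pair_form :: "nat \<Rightarrow> nat set \<Rightarrow> (nat \<Rightarrow> nat) \<Rightarrow> nat \<Rightarrow> ((nat \<Rightarrow> nat) \<Rightarrow> real) \<Rightarrow> bool" where
  "pair_form q S \<mu> a f \<longleftrightarrow> (\<exists>R rs gs c. R \<union> set rs = S \<and> R \<inter> set rs = {} \<and> distinct rs \<and>
     length rs = 2 * a \<and> length gs = a \<and> set gs \<subseteq> A1 q \<and>
     (\<forall>x\<in>cube q S. f x = c * block_prod (map (Pair 2) gs) (map x rs) *
        (\<Prod>r\<in>R. if x r = \<mu> r then 1 else 0)))"

lemma pair_formI:
  assumes "R \<union> set rs = S" "R \<inter> set rs = {}" "distinct rs" "length rs = 2 * a" "length gs = a"
    "set gs \<subseteq> A1 q"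
    "\<And>x. x \<in> cube q S \<Longrightarrow> f x = c * block_prod (map (Pair 2) gs) (map x rs) *
        (\<Prod>r\<in>R. if x r = \<mu> r then 1 else 0)"
  shows "pair_form q S \<mu> a f"
  unfolding pair_form_def
  by (intro exI[of _ R] exI[of _ rs] exI[of _ gs] exI[of _ c] conjI ballI assms)

lemma pair_formE:
  assumes "pair_form q S \<mu> a f"
  obtains R rs gs c where "R \<union> set rs = S" "R \<inter> set rs = {}" "distinct rs" "length rs = 2 * a"
    "length gs = a" "set gs \<subseteq> A1 q"
    "\<And>x. x \<in> cube q S \<Longrightarrow> f x = c * block_prod (map (Pair 2) gs) (map x rs) *
        (\<Prod>r\<in>R. if x r = \<mu> r then 1 else 0)"
  using assms unfolding pair_form_def by (elim exE conjE) (rule that, assumption+, erule bspec)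

section \<open>Extending and reducing pair forms\<close>

lemma pair_form_single:
  assumes "finite S" "r \<in> S" "pair_form q (S - {r}) \<mu> a (slice r (\<mu> r) f)"
    "\<And>k x. k < q \<Longrightarrow> k \<noteq> \<mu> r \<Longrightarrow> x \<in> cube q (S - {r}) \<Longrightarrow> slice r k f x = 0"
  shows "pair_form q S \<mu> a f"
proof -
  obtain R rs gs c where R: "R \<union> set rs = S - {r}" "R \<inter> set rs = {}" "distinct rs"
      "length rs = 2 * a" "length gs = a" "set gs \<subseteq> A1 q"
    and f: "\<And>x. x \<in> cube q (S - {r}) \<Longrightarrow> slice r (\<mu> r) f x =
      c * block_prod (map (Pair 2) gs) (map x rs) * (\<Prod>r\<in>R. if x r = \<mu> r then 1 else 0)"
    by (rule pair_formE[OF assms(3)], rule that)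
  have rR: "r \<notin> R" "r \<notin> set rs" "finite R" using R(1) assms(1) by (auto intro: finite_subset)
  have "f x = c * block_prod (map (Pair 2) gs) (map x rs) *
      (\<Prod>t\<in>insert r R. if x t = \<mu> t then 1 else 0)" if "x \<in> cube q S" for x
  proof -
    obtain y k where y: "y \<in> cube q (S - {r})" "k < q" and x: "x = y(r := k)"
      using cube_split[OF \<open>x \<in> cube q S\<close> assms(2)] by blast
    have 1: "map x rs = map y rs" using rR by (auto simp: x)
    have "(\<Prod>t\<in>R. if x t = \<mu> t then 1 else 0 :: real) = (\<Prod>t\<in>R. if y t = \<mu> t then 1 else 0)"
      using rR by (intro prod.cong) (auto simp: x)
    then have 2: "(\<Prod>t\<in>insert r R. if x t = \<mu> t then 1 else 0 :: real) =
        (if k = \<mu> r then \<Prod>t\<in>R. if y t = \<mu> t then 1 else 0 else 0)"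
      using rR by (simp add: x)
    have "f x = slice r k f y" by (simp only: x slice_def)
    then show ?thesis unfolding 1 2 using f[OF y(1)] assms(4)[OF y(2) _ y(1)] by auto
  qed
  moreover have "insert r R \<union> set rs = S" "insert r R \<inter> set rs = {}" using R rR assms(2) by auto
  ultimately show ?thesis using R by (intro pair_formI)
qed

text \<open>\<open>g\<close> is the slice at an ordinary letter in \<open>r\<close> and at
  \<open>\<mu> t\<close> in \<open>t\<close>. There \<open>a1 (\<mu> r) (\<mu> t)\<close> takes the
  value -1, whence the sign.\<close>

lemma pair_form_pair:
  assumes "r \<in> S" "t \<in> S" "r \<noteq> t" "\<mu> r < q" "\<mu> t < q" "pair_form q (S - {r} - {t}) \<mu> a g"
    "\<And>k l x. k < q \<Longrightarrow> l < q \<Longrightarrow> x \<in> cube q (S - {r} - {t}) \<Longrightarrow>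
      slice t l (slice r k f) x = a1 (\<mu> r) (\<mu> t) [k, l] * - g x"
  shows "pair_form q S \<mu> (Suc a) f"
proof -
  obtain R rs gs c where R: "R \<union> set rs = S - {r} - {t}" "R \<inter> set rs = {}" "distinct rs"
      "length rs = 2 * a" "length gs = a" "set gs \<subseteq> A1 q"
    and g: "\<And>x. x \<in> cube q (S - {r} - {t}) \<Longrightarrow> g x =
      c * block_prod (map (Pair 2) gs) (map x rs) * (\<Prod>r\<in>R. if x r = \<mu> r then 1 else 0)"
    by (rule pair_formE[OF assms(6)], rule that)
  have rt: "r \<notin> R" "r \<notin> set rs" "t \<notin> R" "t \<notin> set rs" using R(1) by auto
  let ?gs = "a1 (\<mu> r) (\<mu> t) # gs" and ?rs = "r # t # rs"
  have "f x = - c * block_prod (map (Pair 2) ?gs) (map x ?rs) *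
      (\<Prod>r\<in>R. if x r = \<mu> r then 1 else 0)" if "x \<in> cube q S" for x
  proof -
    obtain y k where y: "y \<in> cube q (S - {r})" "k < q" and x: "x = y(r := k)"
      using cube_split[OF \<open>x \<in> cube q S\<close> assms(1)] by blast
    have "t \<in> S - {r}" using assms by auto
    then obtain z l where z: "z \<in> cube q (S - {r} - {t})" "l < q" and y': "y = z(t := l)"
      using cube_split[OF y(1)] by blast
    have 1: "map x rs = map z rs" "x r = k" "x t = l" using rt assms(3) by (auto simp: x y')
    have 2: "(\<Prod>t\<in>R. if x t = \<mu> t then 1 else 0 :: real) = (\<Prod>t\<in>R. if z t = \<mu> t then 1 else 0)"
      using rt by (intro prod.cong) (auto simp: x y')
    have "f x = slice t l (slice r k f) z" by (simp only: x y' slice_def)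
    also have "\<dots> = a1 (\<mu> r) (\<mu> t) [k, l] * - g z" using assms(7) y(2) z by blast
    finally show ?thesis unfolding 2 list.map 1 using g[OF z(1)] by (simp add: numeral_2_eq_2)
  qed
  moreover have "R \<union> set ?rs = S" "R \<inter> set ?rs = {}" "distinct ?rs" "length ?rs = 2 * Suc a"
    "length ?gs = Suc a" using R rt assms by auto
  moreover have "set ?gs \<subseteq> A1 q" using R assms by (auto simp: A1_def)
  ultimately show ?thesis by (intro pair_formI)
qed

text \<open>The pairs occupy only \<open>2 * a\<close> coordinates, so \<open>R\<close> is nonempty,
  and any of its elements can be split off.\<close>

lemma pair_form_remove:
  assumes "finite S" "pair_form q S \<mu> a f" "2 * a < card S" "\<And>r. r \<in> S \<Longrightarrow> \<mu> r < q"
  obtains r where "r \<in> S" "pair_form q (S - {r}) \<mu> a (slice r (\<mu> r) f)"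
    "\<And>k x. k < q \<Longrightarrow> k \<noteq> \<mu> r \<Longrightarrow> x \<in> cube q (S - {r}) \<Longrightarrow> slice r k f x = 0"
proof -
  obtain R rs gs c where R: "R \<union> set rs = S" "R \<inter> set rs = {}" "distinct rs"
      "length rs = 2 * a" "length gs = a" "set gs \<subseteq> A1 q"
    and f: "\<And>x. x \<in> cube q S \<Longrightarrow> f x =
      c * block_prod (map (Pair 2) gs) (map x rs) * (\<Prod>r\<in>R. if x r = \<mu> r then 1 else 0)"
    by (rule pair_formE[OF assms(2)], rule that)
  have "R \<noteq> {}"
  proof
    assume "R = {}"
    then have "card S = 2 * a" using R distinct_card[of rs] by simp
    then show False using assms(3) by simp
  qed
  then obtain r where rR: "r \<in> R" by blast
  then have r: "r \<in> S" "r \<notin> set rs" "finite R" using R(1,2) assms(1) by (auto intro: finite_subset)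
  have sl: "slice r k f x = c * block_prod (map (Pair 2) gs) (map x rs) *
      ((if k = \<mu> r then 1 else 0) * (\<Prod>r\<in>R - {r}. if x r = \<mu> r then 1 else 0))"
    if "k < q" "x \<in> cube q (S - {r})" for k x
  proof -
    have 1: "map (x(r := k)) rs = map x rs" using r by auto
    have 2: "(\<Prod>t\<in>R. if (x(r := k)) t = \<mu> t then 1 else 0 :: real) =
       (if k = \<mu> r then 1 else 0) * (\<Prod>t\<in>R - {r}. if x t = \<mu> t then 1 else 0)"
      using rR r by (subst prod.remove[of R r]) (auto intro!: prod.cong)
    show ?thesis
      using f[OF cube_upd[OF that(2) r(1) that(1)]] unfolding slice_def 1 2 .
  qed
  have "(R - {r}) \<union> set rs = S - {r}" "(R - {r}) \<inter> set rs = {}" using R r by auto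
  moreover have "slice r (\<mu> r) f x =
      c * block_prod (map (Pair 2) gs) (map x rs) * (\<Prod>r\<in>R - {r}. if x r = \<mu> r then 1 else 0)"
    if "x \<in> cube q (S - {r})" for x
    using sl[OF assms(4)[OF r(1)] that] by simp
  ultimately have "pair_form q (S - {r}) \<mu> a (slice r (\<mu> r) f)"
    using R(3-6) by (intro pair_formI)
  then show thesis using that[OF r(1)] sl by simp
qed

text \<open>Let w be the claimed value and \<open>g\<close>, \<open>h\<close> the ordinary and the
  exceptional slice. The total 2 (q - 1) w equals (q - 2)|g| + (|g| + |h|). If \<open>h\<close>
  differs from \<open>g\<close>, then |g| + |h| is at least q w, which leaves |g| <= w, and |g| >= w
  holds by the bound for slices.\<close>

lemma uniform_equality_slice:
  assumes "3 \<le> q" "finite S" "card S = Suc n" "band q (Suc n) S a a f" "uniform q S \<mu> f"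
    "supp_card q S f = (2 * (q - 1)) ^ a" "r \<in> S" "m < q" "m \<noteq> \<mu> r"
    "supp_card q (S - {r}) (slice r m f) \<noteq> 0"
  shows "a \<noteq> 0" "supp_card q (S - {r}) (slice r m f) = (2 * (q - 1)) ^ (a - 1)"
proof -
  define T where "T = S - {r}"
  have T: "finite T" "card T = n" using assms by (auto simp: T_def)
  have \<mu>: "\<mu> r < q" using uniformD(1)[OF assms(5,7)] .
  define g h where "g = slice r m f" and "h = slice r (\<mu> r) f"
  define G H where "G = supp_card q T g" and "H = supp_card q T h"
  \<comment> \<open>Here \<open>p\<close> is q - 3, one less than the number of ordinary slices not
    grouped with \<open>h\<close>.\<close>
  obtain p where p: "q = p + 3" using assms(1) by (metis add.commute le_Suc_ex)
  have G0: "0 < G" using assms(10) by (simp add: G_def g_def T_def)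
  have "supp_card q S f = (q - 1) * G + H"
    using uniform_supp_card_split[OF assms(5,2,7-9)] by (simp add: G_def H_def g_def h_def T_def)
  moreover have "(q - 1) * G = p * G + G + G" by (simp add: p)
  ultimately have supp: "(2 * (q - 1)) ^ a = p * G + G + (G + H)" using assms(6) by simp
  \<comment> \<open>For \<open>a = 0\<close> the support would be one point, but at least two
    ordinary letters have nonempty slices.\<close>
  show a: "a \<noteq> 0"
  proof
    assume "a = 0"
    then show False using supp G0 by simp
  qed
  define w where "w = (2 * (q - 1)) ^ (a - 1)"
  have w: "uniform_bound q (a - 1) (a - 1) = w" "uniform_bound q (a - 1) a = q * w"
      "uniform_bound q a (a - 1) = q * w" "(2 * (q - 1)) ^ a = 2 * (p + 2) * w" "0 < w"
  proof -
    obtain c where c: "a = Suc c" using a by (cases a) auto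
    show "uniform_bound q (a - 1) (a - 1) = w" "uniform_bound q (a - 1) a = q * w"
      "uniform_bound q a (a - 1) = q * w"
      by (simp_all add: uniform_bound_def w_def c)
    show "(2 * (q - 1)) ^ a = 2 * (p + 2) * w" "0 < w" by (simp_all add: w_def c p)
  qed
  have ug: "uniform q T \<mu> g" and uh: "uniform q T \<mu> h"
    using uniform_slice[OF assms(5,7)] assms(8) \<mu> by (auto simp: g_def h_def T_def)
  have q2: "2 \<le> q" using assms(1) by simp
  note ub = uniform_bound_le_supp_card[OF q2 T]
  have wG: "w \<le> G"
    using ub[OF _ ug, of "a - 1" "a - 1"] band_slice[OF assms(4,7,8)] G0
    by (simp add: G_def g_def T_def flip: w(1))
  show "supp_card q (S - {r}) (slice r m f) = (2 * (q - 1)) ^ (a - 1)"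
  proof (cases "supp_card q T (\<lambda>x. h x - g x) = 0")
    case True
    \<comment> \<open>This case is contradictory: \<open>g\<close> satisfies the stronger bound q w,
      and \<open>f\<close> consists of \<open>q\<close> copies of it.\<close>
    then have z: "h x = g x" if "x \<in> cube q T" for x
      using that T by (simp add: supp_card_eq_0_iff)
    have "band q n T a (a - 1) (\<lambda>x. real q * g x)"
    proof (rule band_cong[THEN iffD1])
      show "band q n T a (a - 1) (\<lambda>x. \<Sum>k<q. slice r k f x)"
        using band_sumD[OF assms(4,7)] by (simp add: T_def)
    qed (use uniform_sum_slices[OF assms(5,7-9)] z in \<open>simp add: g_def h_def T_def algebra_simps\<close>)
    then have "band q n T a (a - 1) g" using assms(1) by (subst (asm) band_scale_iff; simp)
    from ub[OF this ug] have "q * w \<le> G" using G0 unfolding w(3) G_def by simp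
    moreover have "(2 * (q - 1)) ^ a \<le> 2 * (q * w)" unfolding w(4) by (simp add: p algebra_simps)
    ultimately have "p * G + G + (G + H) \<le> 2 * G" using supp by linarith
    moreover have "H = G" using z by (auto simp: G_def H_def intro: supp_card_cong)
    ultimately show ?thesis using G0 by simp
  next
    case False
    have "band q n T (a - 1) a (\<lambda>x. h x - g x)"
      using band_diffD[OF assms(4,7) \<mu> assms(8)] by (simp add: g_def h_def T_def)
    from ub[OF this _ False] have "q * w \<le> supp_card q T (\<lambda>x. h x - g x)"
      using uniform_lincomb[OF uh ug, of 1 "- 1"] unfolding w(2) by simp
    also have "\<dots> \<le> G + H" using supp_card_diff_le[OF T(1), of q h g] by (simp add: G_def H_def add.commute)
    finally have "p * G + G + (p + 3) * w \<le> 2 * (p + 2) * w" 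
      using supp[unfolded w(4)] unfolding p by linarith
    then have "p * G + G + (p * w + 3 * w) \<le> 2 * (p * w) + 4 * w" by (simp add: algebra_simps)
    moreover have "p * w \<le> p * G" using wG by simp
    ultimately have "G \<le> w" by linarith
    then show ?thesis using wG by (simp add: G_def g_def T_def w_def)
  qed
qed

text \<open>If an ordinary slice vanishes, that coordinate carries a factor from \<open>A_4\<close>
  and the exceptional slice keeps the full band. Otherwise every ordinary slice is minimal for
  \<open>a - 1\<close>, hence has itself an \<open>A_4\<close> coordinate \<open>t\<close>; the
  slices over the two coordinates \<open>r\<close> and \<open>t\<close> then turn out to form a
  factor from \<open>A_1\<close>.\<close>

lemma uniform_equality:
  assumes "4 \<le> q" "finite S" "card S = n" "band q n S a a f" "uniform q S \<mu> f"
    "supp_card q S f = (2 * (q - 1)) ^ a"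
  shows "pair_form q S \<mu> a f"
  using assms(2-)
proof (induction n arbitrary: S a f)
  case 0
  then have S: "S = {}" by simp
  have "supp_card q S f \<noteq> 0" using 0 assms(1) by simp
  then have "a = 0" using 0(3) supp_card_eq_0_iff[OF 0(1)] by auto
  moreover have "f x = f (\<lambda>_. undefined)" if "x \<in> cube q S" for x
    using that by (simp add: S cube_def)
  ultimately show ?case unfolding pair_form_def
    by (intro exI[of _ "{}"] exI[of _ "[]"] exI[of _ "f (\<lambda>_. undefined)"]) (simp add: S)
next
  case (Suc n)
  note u = Suc.prems(4)
  have T: "finite (S - {r})" "card (S - {r}) = n" if "r \<in> S" for r using Suc.prems that by auto
  have \<mu>: "\<mu> r < q" if "r \<in> S" for r using uniformD(1)[OF u that] .
  define m where "m r = (if \<mu> r = 0 then 1 else 0 :: nat)" for r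
  have m: "m r < q" "m r \<noteq> \<mu> r" for r using assms(1) by (auto simp: m_def)
  show ?case
  proof (cases "\<exists>r\<in>S. supp_card q (S - {r}) (slice r (m r) f) = 0")
    case True
    then obtain r where r: "r \<in> S" and z: "supp_card q (S - {r}) (slice r (m r) f) = 0" by blast
    then have z': "slice r (m r) f x = 0" if "x \<in> cube q (S - {r})" for x
      using that T[OF r] by (simp add: supp_card_eq_0_iff)
    have "band q n (S - {r}) (a - 1) a (slice r (\<mu> r) f)"
      by (rule band_cong[THEN iffD1, OF _ band_diffD[OF Suc.prems(3) r \<mu>[OF r] m(1)[of r]]]) (simp add: z')
    moreover have "band q n (S - {r}) a (a - 1) (slice r (\<mu> r) f)"
      by (rule band_cong[THEN iffD1, OF _ band_sumD[OF Suc.prems(3) r]])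
        (simp add: z' uniform_sum_slices[OF u r m[of r]])
    ultimately have "band q n (S - {r}) a a (slice r (\<mu> r) f)" by (rule band_join)
    moreover have "supp_card q (S - {r}) (slice r (\<mu> r) f) = (2 * (q - 1)) ^ a"
      using uniform_supp_card_split[OF u Suc.prems(1) r m[of r]] z Suc.prems(5) by simp
    ultimately have "pair_form q (S - {r}) \<mu> a (slice r (\<mu> r) f)"
      using T[OF r] uniform_slice[OF u r \<mu>[OF r]] by (intro Suc.IH) auto
    then show ?thesis
    proof (rule pair_form_single[OF Suc.prems(1) r])
      fix k x assume "k < q" "k \<noteq> \<mu> r" "x \<in> cube q (S - {r})"
      then show "slice r k f x = 0" using uniformD(2)[OF u r, of k "m r" x] m z' by simp
    qed
  next
    case False
    define w where "w = (2 * (q - 1)) ^ (a - 1)"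
    have q3: "3 \<le> q" using assms(1) by simp
    have Gw: "a \<noteq> 0 \<and> supp_card q (S - {r}) (slice r (m r) f) = w" if "r \<in> S" for r
      using uniform_equality_slice[OF q3 Suc.prems that m[of r]] False that by (auto simp: w_def)
    obtain r where r: "r \<in> S" using Suc.prems(2) by fastforce
    have a: "a \<noteq> 0" using Gw[OF r] by simp
    have aw: "(2 * (q - 1)) ^ a = 2 * (q - 1) * w" "0 < w"
      using a assms(1) by (cases a; simp add: w_def)+
    have "supp_card q S f \<noteq> 0" using Suc.prems(5) assms(1) by simp
    \<comment> \<open>A nonzero function needs a nonempty index interval. Hence \<open>a - 1\<close>
      pairs cannot exhaust the coordinates of \<open>g\<close>, and one \<open>A_4\<close>
      coordinate remains.\<close>
    then have "2 * a \<le> Suc n"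
      unfolding supp_card_eq_0_iff[OF Suc.prems(1)] using band_eq_0[OF Suc.prems(3,2,1)] by fastforce
    then have an: "2 * (a - 1) < card (S - {r})" using T[OF r] a by simp
    define g h where "g = slice r (m r) f" and "h = slice r (\<mu> r) f"
    have ug: "uniform q (S - {r}) \<mu> g" and uh: "uniform q (S - {r}) \<mu> h"
      using uniform_slice[OF u r] m[of r] \<mu>[OF r] by (auto simp: g_def h_def)
    have pg: "pair_form q (S - {r}) \<mu> (a - 1) g"
      using T[OF r] ug band_slice[OF Suc.prems(3) r m(1)[of r]] Gw[OF r] by (intro Suc.IH) (auto simp: g_def w_def)
    have \<mu>': "\<And>t. t \<in> S - {r} \<Longrightarrow> \<mu> t < q" using \<mu> by blast
    obtain t where t: "t \<in> S - {r}"
      and form: "pair_form q (S - {r} - {t}) \<mu> (a - 1) (slice t (\<mu> t) g)"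
      and gz: "\<And>k x. k < q \<Longrightarrow> k \<noteq> \<mu> t \<Longrightarrow> x \<in> cube q (S - {r} - {t}) \<Longrightarrow> slice t k g x = 0"
      by (rule pair_form_remove[OF T(1)[OF r] pg an \<mu>'], assumption, rule that)
    have tS: "t \<in> S" "r \<noteq> t" "r \<in> S - {t}" using t r by auto
    define X where "X = S - {r} - {t}"
    have X: "S - {t} - {r} = X" "S - {r} - {t} = X" by (auto simp: X_def)
    obtain n' where n': "n = Suc n'" using T[OF r] t by (cases n) auto
    have cX: "finite X" "card X = n'" using T[OF r] t by (auto simp: X_def n')
    \<comment> \<open>The first digit refers to \<open>r\<close>, the second to \<open>t\<close>; 0
      stands for the exceptional letter and 1 for an ordinary one.\<close>
    define f00 f01 f10 where "f00 = slice t (\<mu> t) h" and "f01 = slice t (m t) h"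
      and "f10 = slice t (\<mu> t) g"
    have f11: "slice t (m t) g x = 0" if "x \<in> cube q X" for x using gz[OF m[of t]] that by (simp add: X)
    then have s11: "supp_card q X (slice t (m t) g) = 0" using cX by (simp add: supp_card_eq_0_iff)
    have s10: "supp_card q X f10 = w"
      using uniform_supp_card_split[OF ug T(1)[OF r] t m[of t]] Gw[OF r] s11 by (simp add: X f10_def g_def)
    have "supp_card q X (slice r (\<mu> r) (slice t (m t) f)) = w"
      using uniform_supp_card_split[OF uniform_slice[OF u tS(1) m(1)[of t]] T(1)[OF tS(1)] tS(3) m[of r]]
        Gw[OF tS(1)] s11 tS(2) by (simp add: X g_def slice_commute[of r t])
    then have s01: "supp_card q X f01 = w" using tS(2) by (simp add: f01_def h_def slice_commute[of r t])
    \<comment> \<open>The copies of \<open>f10\<close> and of \<open>f01\<close> contribute (q - 1)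
      w each. This is already the whole support, so nothing is left for \<open>f00\<close>.\<close>
    have "supp_card q S f = (q - 1) * w + ((q - 1) * w + supp_card q X f00)"
      using uniform_supp_card_split[OF u Suc.prems(1) r m[of r]] Gw[OF r]
        uniform_supp_card_split[OF uh T(1)[OF r] t m[of t]] s01 by (simp add: X f00_def f01_def h_def)
    then have "supp_card q X f00 = 0" using Suc.prems(5) aw by simp
    then have f00: "f00 x = 0" if "x \<in> cube q X" for x using that cX by (simp add: supp_card_eq_0_iff)
    \<comment> \<open>Since \<open>f00\<close> and the slice at two ordinary letters vanish, the
      mixed second difference over \<open>r\<close> and \<open>t\<close> and the sum over both
      coordinates are nonzero multiples of \<open>f10 + f01\<close>. Intersecting their bands gives
      \<open>a\<close>, \<open>a\<close>, where a nonzero function needs more than 2 w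
      points.\<close>
    have bd: "band q n' X (a - 1 - 1) a (\<lambda>x. (- 1) * (f10 x + f01 x))"
    proof (rule band_cong[THEN iffD1])
      have "band q (Suc n') (S - {r}) (a - 1) a (\<lambda>x. h x - g x)"
        using band_diffD[OF Suc.prems(3) r \<mu>[OF r] m(1)[of r]] by (simp only: g_def h_def n')
      from band_diffD[OF this t \<mu>[OF tS(1)] m(1)[of t]]
      show "band q n' X (a - 1 - 1) a
          (\<lambda>x. slice t (\<mu> t) (\<lambda>x. h x - g x) x - slice t (m t) (\<lambda>x. h x - g x) x)"
        by (simp only: X)
      fix x assume "x \<in> cube q X"
      then show "slice t (\<mu> t) (\<lambda>x. h x - g x) x - slice t (m t) (\<lambda>x. h x - g x) x =
          (- 1) * (f10 x + f01 x)"
        using f00[of x] f11[of x] by (simp add: f00_def f01_def f10_def slice_def)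
    qed
    have bs: "band q n' X a (a - 1 - 1) (\<lambda>x. (real q - 1) * (f10 x + f01 x))"
    proof (rule band_cong[THEN iffD1])
      have "band q n (S - {r}) a (a - 1) (\<lambda>x. 1 * h x + (real q - 1) * g x)"
        by (rule band_cong[THEN iffD1, OF _ band_sumD[OF Suc.prems(3) r]])
          (simp add: uniform_sum_slices[OF u r m[of r]] g_def h_def)
      from band_sumD[OF this[unfolded n'] t]
      show "band q n' X a (a - 1 - 1) (\<lambda>x. \<Sum>k<q. slice t k (\<lambda>x. 1 * h x + (real q - 1) * g x) x)"
        by (simp only: X)
      fix x assume x: "x \<in> cube q X"
      have "(\<Sum>k<q. slice t k (\<lambda>x. 1 * h x + (real q - 1) * g x) x) =
          slice t (\<mu> t) (\<lambda>x. 1 * h x + (real q - 1) * g x) x +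
          (real q - 1) * slice t (m t) (\<lambda>x. 1 * h x + (real q - 1) * g x) x"
        using x by (intro uniform_sum_slices[OF uniform_lincomb[OF uh ug] t m]) (simp add: X)
      also have "\<dots> = (real q - 1) * (f10 x + f01 x)"
        using f00[OF x] f11[OF x] by (simp add: f00_def f01_def f10_def slice_def algebra_simps)
      finally show "(\<Sum>k<q. slice t k (\<lambda>x. 1 * h x + (real q - 1) * g x) x) =
          (real q - 1) * (f10 x + f01 x)" .
    qed
    have "band q n' X (a - 1 - 1) a (\<lambda>x. f10 x + f01 x)"
      using bd by (subst (asm) band_scale_iff) auto
    moreover have "band q n' X a (a - 1 - 1) (\<lambda>x. f10 x + f01 x)"
      using bs assms(1) by (subst (asm) band_scale_iff) auto
    ultimately have "band q n' X (max (a - 1 - 1) a) (max a (a - 1 - 1)) (\<lambda>x. f10 x + f01 x)"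
      by (rule band_max)
    then have bu: "band q n' X a a (\<lambda>x. f10 x + f01 x)" by (simp add: max_absorb1 max_absorb2)
    have "supp_card q X (\<lambda>x. f10 x + f01 x) \<le> w + w"
      using supp_card_le_add[OF cX(1), of q f10 f01 "\<lambda>x. f10 x + f01 x"] s10 s01 by simp
    also have "\<dots> < band_bound q a a"
    proof -
      have "2 * w < 2 * (q - 1) * w" using aw(2) assms(1) by (intro mult_strict_right_mono) auto
      moreover have "band_bound q a a = 2 * (q - 1) * w" using aw(1) by (simp add: band_bound_def)
      ultimately show ?thesis by linarith
    qed
    finally have "supp_card q X (\<lambda>x. f10 x + f01 x) = 0"
      using band_bound_le_supp_card[OF assms(1) cX bu] by force
    then have opp: "f01 x = - f10 x" if "x \<in> cube q X" for x
      using that cX by (force simp: supp_card_eq_0_iff)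
    have "pair_form q S \<mu> (Suc (a - 1)) f"
    proof (rule pair_form_pair[OF r tS(1,2) \<mu>[OF r] \<mu>[OF tS(1)] form])
      fix k l x assume k: "k < q" and l: "l < q" and x: "x \<in> cube q (S - {r} - {t})"
      have 1: "slice t l (slice r k f) x = slice t l g x" if "k \<noteq> \<mu> r"
        using uniformD(2)[OF u r k m(1)[of r] that m(2)[of r] cube_upd[OF x t l]] by (simp add: slice_def g_def)
      have 2: "slice t l h x = f01 x" if "l \<noteq> \<mu> t"
        using uniformD(2)[OF uh t l m(1)[of t] that m(2)[of t] x] by (simp add: f01_def)
      show "slice t l (slice r k f) x = a1 (\<mu> r) (\<mu> t) [k, l] * - slice t (\<mu> t) g x"
      proof (cases "k = \<mu> r"; cases "l = \<mu> t")
        assume "k = \<mu> r" "l = \<mu> t"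
        then show ?thesis using f00[of x] x by (simp add: a1_def f00_def h_def X)
      next
        assume "k = \<mu> r" "l \<noteq> \<mu> t"
        then show ?thesis using 2 opp[of x] x by (simp add: a1_def h_def f10_def X)
      next
        assume "k \<noteq> \<mu> r" "l = \<mu> t"
        then show ?thesis using 1 by (simp add: a1_def)
      next
        assume "k \<noteq> \<mu> r" "l \<noteq> \<mu> t"
        then show ?thesis using 1 gz[OF l _ x] by (simp add: a1_def)
      qed
    qed
    then show ?thesis using a by simp
  qed
qed

section \<open>The case of equality\<close>

lemma block_prod_append:
  "length xs = sum_list (map fst fs) \<Longrightarrow>
    block_prod (fs @ gs) (xs @ ys) = block_prod fs xs * block_prod gs ys"
  by (induction fs xs rule: block_prod.induct) auto

lemma band_pair_bound:
  assumes "4 \<le> q" "finite S" "card S = Suc n" "band q (Suc n) S a b f" "r \<in> S" "k < q" "l < q"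
    "\<exists>x\<in>cube q (S - {r}). slice r k f x \<noteq> slice r l f x"
  shows "band_bound q (a - 1) b \<le>
    supp_card q (S - {r}) (slice r k f) + supp_card q (S - {r}) (slice r l f)"
proof -
  have T: "finite (S - {r})" "card (S - {r}) = n" using assms by auto
  have "supp_card q (S - {r}) (\<lambda>x. slice r k f x - slice r l f x) \<noteq> 0"
    using assms(8) T(1) by (simp add: supp_card_eq_0_iff)
  from band_bound_le_supp_card[OF assms(1) T band_diffD[OF assms(4-7)] this]
  have "band_bound q (a - 1) b \<le> supp_card q (S - {r}) (\<lambda>x. slice r k f x - slice r l f x)" .
  also have "\<dots> \<le> supp_card q (S - {r}) (slice r k f) + supp_card q (S - {r}) (slice r l f)"
    using T(1) by (rule supp_card_diff_le)
  finally show ?thesis .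
qed

text \<open>\<open>rs\<close> lists the coordinates in the order in which the factors consume them;
  it later supplies the permutation.\<close>

definition product_form :: "nat \<Rightarrow> nat set \<Rightarrow> nat \<Rightarrow> nat \<Rightarrow> ((nat \<Rightarrow> nat) \<Rightarrow> real) \<Rightarrow> bool" where
  "product_form q S b d f \<longleftrightarrow> (\<exists>rs gs hs c. distinct rs \<and> set rs = S \<and> length gs = b \<and> set gs \<subseteq> A1 q \<and>
     length hs = d \<and> set hs \<subseteq> A2 q \<and>
     (\<forall>x\<in>cube q S. f x = c * block_prod (map (Pair 2) gs @ map (Pair 1) hs) (map x rs)))"

lemma product_formI:
  assumes "distinct rs" "set rs = S" "length gs = b" "set gs \<subseteq> A1 q" "length hs = d" "set hs \<subseteq> A2 q"
    "\<And>x. x \<in> cube q S \<Longrightarrow> f x = c * block_prod (map (Pair 2) gs @ map (Pair 1) hs) (map x rs)"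
  shows "product_form q S b d f"
  unfolding product_form_def
  by (intro exI[of _ rs] exI[of _ gs] exI[of _ hs] exI[of _ c] conjI ballI assms)

lemma product_formE:
  assumes "product_form q S b d f"
  obtains rs gs hs c where "distinct rs" "set rs = S" "length gs = b" "set gs \<subseteq> A1 q"
    "length hs = d" "set hs \<subseteq> A2 q"
    "\<And>x. x \<in> cube q S \<Longrightarrow> f x = c * block_prod (map (Pair 2) gs @ map (Pair 1) hs) (map x rs)"
  using assms unfolding product_form_def by (elim exE conjE) (rule that, assumption+, erule bspec)

text \<open>The new coordinate goes to the end of \<open>rs\<close>, so that its factor follows all
  others. The cardinality guarantees that the earlier blocks use up \<open>rs\<close>
  exactly.\<close>

lemma product_form_A2:
  assumes "r \<in> S" "card S = Suc (2 * b + d)" "K < q" "L < q" "K \<noteq> L"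
    "product_form q (S - {r}) b d g"
    "\<And>k x. k < q \<Longrightarrow> x \<in> cube q (S - {r}) \<Longrightarrow> slice r k f x = a2 K L [k] * g x"
  shows "product_form q S b (Suc d) f"
proof -
  obtain rs gs hs c where R: "distinct rs" "set rs = S - {r}" "length gs = b" "set gs \<subseteq> A1 q"
    "length hs = d" "set hs \<subseteq> A2 q" and g: "\<And>x. x \<in> cube q (S - {r}) \<Longrightarrow>
      g x = c * block_prod (map (Pair 2) gs @ map (Pair 1) hs) (map x rs)"
    by (rule product_formE[OF assms(6)], rule that)
  let ?fs = "map (Pair 2) gs @ map (Pair 1) hs"
  have "length rs = 2 * b + d" using distinct_card[OF R(1)] R(2) assms(1,2) by simp
  then have len: "length (map x rs) = sum_list (map fst ?fs)" for x :: "nat \<Rightarrow> nat"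
    using R by (simp add: comp_def sum_list_triv)
  show ?thesis
  proof (rule product_formI)
    fix x assume "x \<in> cube q S"
    then obtain y k where y: "y \<in> cube q (S - {r})" "k < q" and x: "x = y(r := k)"
      using cube_split[OF _ assms(1)] by blast
    have 1: "map x rs = map y rs" "x r = k" using R(2) by (auto simp: x)
    have "f x = slice r k f y" by (simp only: x slice_def)
    also have "\<dots> = a2 K L [k] * (c * block_prod ?fs (map y rs))" using assms(7) y g by simp
    also have "\<dots> = c * block_prod (?fs @ [(1, a2 K L)]) (map x rs @ [x r])"
      unfolding 1 block_prod_append[OF len] by simp
    finally show "f x = c * block_prod (map (Pair 2) gs @ map (Pair 1) (hs @ [a2 K L])) (map x (rs @ [r]))"
      by simp
  qed (use R assms in \<open>auto simp: A2_def\<close>)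
qed

text \<open>In the application \<open>a\<close> is i and \<open>b\<close> is n - i. Each induction
  step splits off one \<open>A_2\<close> coordinate and lowers \<open>a\<close> with
  \<open>b\<close> fixed, down to the uniform case \<open>a = b\<close>.\<close>

lemma band_bound_equality:
  assumes "5 \<le> q" "finite S" "card S = n" "a + b = n" "b \<le> a" "band q n S a b f"
    "supp_card q S f = 2 ^ a * (q - 1) ^ b"
  shows "product_form q S b (a - b) f"
  using assms(2-)
proof (induction n arbitrary: S a f)
  case 0
  then have "S = {}" "a = 0" "b = 0" by auto
  then show ?case by (intro product_formI[of "[]" _ "[]" _ _ "[]" _ _ "f (\<lambda>_. undefined)"]) (auto simp: cube_def)
next
  case (Suc n)
  have q: "4 \<le> q" using assms(1) by simp
  have bb: "band_bound q a b = 2 ^ a * (q - 1) ^ b"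
    using Suc.prems(4) by (auto simp: band_bound_def power_mult_distrib)
  have supp0: "supp_card q S f \<noteq> 0" using Suc.prems(6) assms(1) by simp
  note ub = uniform_bound_le_supp_card[OF _ Suc.prems(1,2,5) _ supp0]
  show ?case
  proof (cases "a = b")
    case True
    obtain \<mu> where \<mu>: "uniform q S \<mu> f"
    proof (rule ccontr)
      assume "\<not> thesis"
      then have "\<not> uniform q S \<mu> f" for \<mu> using that by blast
      from not_uniform_two_pairs[OF q this]
      obtain r k l k' l' where r: "r \<in> S" and kl: "k < q" "l < q" "k' < q" "l' < q" "distinct [k, l, k', l']"
        and ne: "\<exists>x\<in>cube q (S - {r}). slice r k f x \<noteq> slice r l f x"
         "\<exists>x\<in>cube q (S - {r}). slice r k' f x \<noteq> slice r l' f x" .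
      note pair = band_pair_bound[OF q Suc.prems(1,2,5) r]
      have "2 * band_bound q (a - 1) b \<le> supp_card q S f"
        unfolding supp_card_split[OF Suc.prems(1) r] sum_two_pairs[OF kl]
        using pair[OF kl(1,2) ne(1)] pair[OF kl(3,4) ne(2)] by linarith
      moreover have "band_bound q a b < 2 * band_bound q (a - 1) b"
        using band_bound_less_twice_pred[of q a b] True q Suc.prems(3) by simp
      ultimately show False using bb Suc.prems(6) by simp
    qed
    have pf: "pair_form q S \<mu> a f"
      using uniform_equality[OF q Suc.prems(1,2) _ \<mu>, of a] Suc.prems(5,6) True
      by (simp add: power_mult_distrib)
    obtain R rs gs c where R: "R \<union> set rs = S" "R \<inter> set rs = {}" "distinct rs"
        "length rs = 2 * a" "length gs = a" "set gs \<subseteq> A1 q"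
      and f: "\<And>x. x \<in> cube q S \<Longrightarrow> f x = c * block_prod (map (Pair 2) gs) (map x rs) *
        (\<Prod>r\<in>R. if x r = \<mu> r then 1 else 0)"
      by (rule pair_formE[OF pf], rule that)
    \<comment> \<open>The pairs occupy \<open>2 * a\<close> coordinates, which is all of
      \<open>S\<close>, so no factor from \<open>A_4\<close> remains.\<close>
    have "set rs = S"
      using R(1,3,4) distinct_card[OF R(3)] Suc.prems(1-3) True by (intro card_subset_eq) auto
    moreover from this have "R = {}" using R(1,2) by blast
    ultimately show ?thesis using R f True
      by (intro product_formI[of rs _ gs _ _ "[]" _ _ c]) auto
  next
    case False
    then have ba: "b < a" using Suc.prems(4) by simp
    have "\<not> uniform q S \<mu> f" for \<mu>
      using ub[of \<mu>] band_bound_less_uniform_bound[OF _ ba, of q] bb Suc.prems(6) q by auto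
    from not_uniform_two_pairs[OF q this]
    obtain r k l k' l' where r: "r \<in> S" and kl: "k < q" "l < q" "k' < q" "l' < q" "distinct [k, l, k', l']"
      and ne: "\<exists>x\<in>cube q (S - {r}). slice r k f x \<noteq> slice r l f x"
       "\<exists>x\<in>cube q (S - {r}). slice r k' f x \<noteq> slice r l' f x" .
    define T where "T = S - {r}"
    have T: "finite T" "card T = n" using Suc.prems r by (auto simp: T_def)
    define W where "W m = supp_card q T (slice r m f)" for m
    define w where "w = band_bound q (a - 1) b"
    note pair = band_pair_bound[OF q Suc.prems(1,2,5) r, folded T_def W_def w_def]
    have "2 * w = supp_card q S f" using band_bound_twice_pred[OF ba, of q] bb Suc.prems(6) by (simp add: w_def)
    then have total: "2 * w = (W k + W l) + (W k' + W l') + (\<Sum>m\<in>{..<q} - {k, l, k', l'}. W m)"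
      using supp_card_split[OF Suc.prems(1) r, of q f] sum_two_pairs[OF kl, of W] by (simp add: W_def T_def)
    \<comment> \<open>Both pairs cost at least \<open>w\<close> and the total is
      \<open>2 * w\<close>, so all estimates are equalities.\<close>
    have kw: "W k + W l = w" "W k' + W l' = w" and "(\<Sum>m\<in>{..<q} - {k, l, k', l'}. W m) = 0"
      using total pair[OF kl(1,2) ne(1)[folded T_def]] pair[OF kl(3,4) ne(2)[folded T_def]]
      unfolding W_def[symmetric] by linarith+
    then have rest: "W m = 0" if "m < q" "m \<notin> {k, l, k', l'}" for m using that by simp
    have w0: "0 < w" using \<open>2 * w = supp_card q S f\<close> supp0 by simp
    have zero: "slice r m f x = 0" if "W m = 0" "x \<in> cube q T" for m x
      using that T by (simp add: W_def supp_card_eq_0_iff)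
    \<comment> \<open>This is where \<open>5 \<le> q\<close> enters: a fifth letter has a vanishing
      slice. Every slice is then a difference with that one and lies in the band
      \<open>a - 1\<close>, \<open>b\<close>, instead of merely \<open>a - 1\<close>,
      \<open>b - 1\<close>.\<close>
    have "{..<q} - {k, l, k', l'} \<noteq> {}"
    proof
      assume "{..<q} - {k, l, k', l'} = {}"
      then have "card {..<q} \<le> card {k, l, k', l'}" by (intro card_mono) auto
      also have "\<dots> \<le> 4" using card_length[of "[k, l, k', l']"] by simp
      finally show False using assms(1) by simp
    qed
    then obtain m0 where m0: "m0 < q" "W m0 = 0" using rest by blast
    have bm: "band q n T (a - 1) b (slice r m f)" if "m < q" for m
      using band_diffD[OF Suc.prems(5) r that m0(1)] zero[OF m0(2)]
      unfolding T_def by (simp cong: band_cong)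
    have big: "w \<le> W m" if "m < q" "W m \<noteq> 0" for m
      using band_bound_le_supp_card[OF q T bm[OF that(1)]] that(2) by (simp add: w_def W_def)
    have ex: "\<exists>K\<in>{k, l}. W K = w \<and> (\<forall>m\<in>{k, l}. m \<noteq> K \<longrightarrow> W m = 0)"
      if "k < q" "l < q" "W k + W l = w" for k l
    proof -
      \<comment> \<open>Nonzero slices weigh at least \<open>w\<close>, so a pair of total weight
        \<open>w\<close> has exactly one nonzero member.\<close>
      have "W k = 0 \<or> W l = 0" using big[OF that(1)] big[OF that(2)] that(3) w0 by linarith
      then show ?thesis using that(3) by auto
    qed
    obtain K where K: "K \<in> {k, l}" "K < q" "W K = w" "\<And>m. m \<in> {k, l} \<Longrightarrow> m \<noteq> K \<Longrightarrow> W m = 0"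
      using ex[OF kl(1,2) kw(1)] kl(1,2) by blast
    obtain L where L: "L \<in> {k', l'}" "L < q" "W L = w" "\<And>m. m \<in> {k', l'} \<Longrightarrow> m \<noteq> L \<Longrightarrow> W m = 0"
      using ex[OF kl(3,4) kw(2)] kl(3,4) by blast
    have KL: "K \<noteq> L" using K(1) L(1) kl(5) by auto
    have z: "slice r m f x = 0" if "m < q" "m \<noteq> K" "m \<noteq> L" "x \<in> cube q T" for m x
      using zero[OF _ that(4)] rest[OF that(1)] K(4) L(4) that(2,3) by blast
    \<comment> \<open>\<open>u\<close> lies in the band \<open>a - 1\<close>, \<open>b\<close> as a
      combination of slices, and in \<open>a\<close>, \<open>b - 1\<close> because it equals the sum
      of all slices. As \<open>a + b\<close> exceeds the remaining dimension, it vanishes.\<close>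
    define u where "u x = 1 * slice r K f x + 1 * slice r L f x" for x
    have "band q n T (a - 1) b u"
      unfolding u_def using bm[OF K(2)] bm[OF L(2)] by (rule band_lincomb)
    moreover have "band q n T a (b - 1) u"
    proof (rule band_cong[THEN iffD1])
      show "band q n T a (b - 1) (\<lambda>x. \<Sum>m<q. slice r m f x)"
        using band_sumD[OF Suc.prems(5) r] by (simp only: T_def)
      fix x assume x: "x \<in> cube q T"
      have "(\<Sum>m<q. slice r m f x) = (\<Sum>m\<in>{K, L}. slice r m f x)"
        using K(2) L(2) z[OF _ _ _ x] by (intro sum.mono_neutral_right) auto
      then show "(\<Sum>m<q. slice r m f x) = u x" using KL by (simp add: u_def)
    qed
    ultimately have "band q n T a b u" by (rule band_join)
    then have "u x = 0" if "x \<in> cube q T" for x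
      using band_eq_0[OF _ T(2,1) _ that] Suc.prems(3) by simp
    then have opp: "slice r L f x = - slice r K f x" if "x \<in> cube q T" for x
      using that by (force simp: u_def)
    have "w = 2 ^ (a - 1) * (q - 1) ^ b"
      using \<open>2 * w = supp_card q S f\<close> Suc.prems(6) ba by (cases a) auto
    then have pf: "product_form q (S - {r}) b (a - 1 - b) (slice r K f)" unfolding T_def[symmetric]
      using T Suc.prems(3) ba bm[OF K(2)] K(3) by (intro Suc.IH) (auto simp: W_def)
    have sl: "slice r m f x = a2 K L [m] * slice r K f x" if "m < q" "x \<in> cube q (S - {r})" for m x
      using z[OF that(1), of x] opp[of x] that(2) KL by (auto simp: a2_def T_def)
    have cS: "card S = Suc (2 * b + (a - 1 - b))" using Suc.prems(2,3) ba by simp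
    have "product_form q S b (Suc (a - 1 - b)) f"
      by (rule product_form_A2[OF r cS K(2) L(2) KL pf sl])
    then show ?thesis using ba by (simp add: Suc_diff_Suc)
  qed
qed

section \<open>Words and eigenfunctions\<close>

text \<open>The hypothesis is the eigenvalue equation with the value at \<open>x\<close> itself
  added once per coordinate. Deleting coordinate \<open>r\<close> subtracts the sum of slices in
  \<open>r\<close>: for that sum, n and n - t both drop by one and \<open>t\<close> stays; for a
  difference of slices the subtracted terms cancel, so \<open>t\<close> drops by one.
  \<open>t\<close> is real since it may become negative once \<open>a\<close> has reached 0.\<close>

lemma band_of_eigenfunction:
  assumes "0 < q" "finite S" "card S = n" "a = 0 \<or> real a \<le> t" "b = 0 \<or> t \<le> real n - real b"
    "\<And>x. x \<in> cube q S \<Longrightarrow> (\<Sum>r\<in>S. \<Sum>k<q. slice r k F x) = real q * (real n - t) * F x"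
  shows "band q n S a b F"
  using assms(2-)
proof (induction n arbitrary: S a b t F)
  case 0
  then have S: "S = {}" by simp
  show ?case
  proof (cases "t = 0")
    case True
    then show ?thesis using 0 by auto
  next
    case False
    \<comment> \<open>With no coordinates the left-hand side of the equation is 0, so
      \<open>t * F x = 0\<close>.\<close>
    then have "F x = 0" if "x \<in> cube q S" for x using "0.prems"(5)[OF that] S assms(1) by simp
    then show ?thesis by simp
  qed
next
  case (Suc n)
  show ?case unfolding band.simps
  proof (intro ballI conjI allI impI)
    fix r assume r: "r \<in> S"
    have T: "finite (S - {r})" "card (S - {r}) = n" using Suc.prems r by auto
    have key: "(\<Sum>s\<in>S - {r}. \<Sum>m<q. slice s m (slice r k F) y) =
        real q * (real (Suc n) - t) * slice r k F y - (\<Sum>m<q. slice r m F y)"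
      if "y \<in> cube q (S - {r})" "k < q" for y k
    proof -
      have "slice s m (slice r k F) y = slice s m F (y(r := k))" if "s \<in> S - {r}" for s m
        using that by (simp add: slice_def fun_upd_twist)
      then have "(\<Sum>s\<in>S - {r}. \<Sum>m<q. slice s m (slice r k F) y) =
          (\<Sum>s\<in>S - {r}. \<Sum>m<q. slice s m F (y(r := k)))" by simp
      also have "\<dots> = (\<Sum>s\<in>S. \<Sum>m<q. slice s m F (y(r := k))) - (\<Sum>m<q. slice r m F (y(r := k)))"
        using Suc.prems(1) r by (simp add: sum_diff1)
      also have "(\<Sum>s\<in>S. \<Sum>m<q. slice s m F (y(r := k))) = real q * (real (Suc n) - t) * F (y(r := k))"
        using that r by (intro Suc.prems(5) cube_upd)
      finally show ?thesis by (simp add: slice_def del: fun_upd_apply)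
    qed
    show "band q n (S - {r}) a (b - 1) (\<lambda>x. \<Sum>k<q. slice r k F x)"
    proof (rule Suc.IH[OF T, of _ t])
      fix y assume y: "y \<in> cube q (S - {r})"
      have "(\<Sum>s\<in>S - {r}. \<Sum>m<q. slice s m (\<lambda>x. \<Sum>k<q. slice r k F x) y) =
          (\<Sum>k<q. \<Sum>s\<in>S - {r}. \<Sum>m<q. slice s m (slice r k F) y)"
        unfolding slice_def[of _ _ "\<lambda>x. \<Sum>k<q. slice r k F x"] slice_def[of _ _ "slice r _ F"]
        by (subst sum.swap, rule sum.cong[OF refl], rule sum.swap)
      also have "\<dots> = (\<Sum>k<q. real q * (real (Suc n) - t) * slice r k F y - (\<Sum>m<q. slice r m F y))"
        using key[OF y] by simp
      also have "\<dots> = real q * (real n - t) * (\<Sum>k<q. slice r k F y)"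
        unfolding sum_subtractf sum_distrib_left[symmetric] by (simp add: algebra_simps)
      finally show "(\<Sum>s\<in>S - {r}. \<Sum>m<q. slice s m (\<lambda>x. \<Sum>k<q. slice r k F x) y) =
          real q * (real n - t) * (\<Sum>k<q. slice r k F y)" .
    qed (use Suc.prems in auto)
    fix k l assume kl: "k < q" "l < q"
    show "band q n (S - {r}) (a - 1) b (\<lambda>x. slice r k F x - slice r l F x)"
    proof (rule Suc.IH[OF T, of _ "t - 1"])
      fix y assume y: "y \<in> cube q (S - {r})"
      have "(\<Sum>s\<in>S - {r}. \<Sum>m<q. slice s m (\<lambda>x. slice r k F x - slice r l F x) y) =
        (\<Sum>s\<in>S - {r}. \<Sum>m<q. slice s m (slice r k F) y) - (\<Sum>s\<in>S - {r}. \<Sum>m<q. slice s m (slice r l F) y)"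
        unfolding slice_def[of _ _ "\<lambda>x. slice r k F x - slice r l F x"] slice_def[of _ _ "slice r _ F"]
        by (simp add: sum_subtractf)
      also have "\<dots> = real q * (real n - (t - 1)) * (slice r k F y - slice r l F y)"
        unfolding key[OF y kl(1)] key[OF y kl(2)] by (simp add: algebra_simps)
      finally show "(\<Sum>s\<in>S - {r}. \<Sum>m<q. slice s m (\<lambda>x. slice r k F x - slice r l F x) y) =
        real q * (real n - (t - 1)) * (slice r k F y - slice r l F y)" .
    qed (use Suc.prems in auto)
  qed
qed

section \<open>Words as points of the cube, and the adjacency sum\<close>

lemma finite_words: "finite (words n q)"
  unfolding words_def using finite_lists_length_eq[of "{..<q}" n] by (simp add: conj_commute)

lemma words_nth_less:
  assumes "w \<in> words n q" "k < n"
  shows "w ! k < q"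
proof -
  have "w ! k \<in> set w" using assms by (simp add: words_def)
  then show ?thesis using assms(1) by (auto simp: words_def)
qed

lemma bij_betw_cube_words: "bij_betw (\<lambda>x. map x [0..<n]) (cube q {..<n}) (words n q)"
proof (rule bij_betw_byWitness[where f' = "\<lambda>w. restrict ((!) w) {..<n}"])
  show "\<forall>x\<in>cube q {..<n}. restrict ((!) (map x [0..<n])) {..<n} = x"
    by (auto simp: cube_def fun_eq_iff restrict_def PiE_def extensional_def)
  show "\<forall>w\<in>words n q. map (restrict ((!) w) {..<n}) [0..<n] = w"
    by (auto simp: words_def intro: nth_equalityI)
  show "(\<lambda>x. map x [0..<n]) ` cube q {..<n} \<subseteq> words n q"
  proof (rule image_subsetI)
    fix x assume "x \<in> cube q {..<n}"
    then have "x k < q" if "k < n" for k using cube_apply_less that by blast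
    then show "map x [0..<n] \<in> words n q" by (auto simp: words_def)
  qed
  show "(\<lambda>w. restrict ((!) w) {..<n}) ` words n q \<subseteq> cube q {..<n}"
  proof (rule image_subsetI)
    fix w assume "w \<in> words n q"
    then have "w ! k < q" if "k < n" for k using words_nth_less that by blast
    then show "restrict ((!) w) {..<n} \<in> cube q {..<n}" by (simp add: cube_def restrict_PiE_iff)
  qed
qed

lemma supp_size_eq_supp_card: "supp_size n q f = supp_card q {..<n} (\<lambda>x. f (map x [0..<n]))"
proof -
  have "bij_betw (\<lambda>x. map x [0..<n]) {x \<in> cube q {..<n}. f (map x [0..<n]) \<noteq> 0} {w \<in> words n q. f w \<noteq> 0}"
    using bij_betw_cube_words by (rule bij_betw_Collect) simp
  then show ?thesis by (simp add: supp_size_def supp_card_def bij_betw_same_card)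
qed

text \<open>Each neighbour is \<open>w[r := k]\<close> for exactly one pair with \<open>k\<close>
  different from \<open>w ! r\<close>; the remaining letter gives back \<open>w\<close> once for
  each of the \<open>n\<close> coordinates.\<close>

lemma sum_hamming_adj:
  assumes "w \<in> words n q"
  shows "(\<Sum>y\<in>{y. hamming_adj n q w y}. f y) + real n * f w = (\<Sum>r<n. \<Sum>k<q. f (w[r := k]))"
proof -
  have w: "length w = n" "\<And>r. r < n \<Longrightarrow> w ! r < q"
    using assms words_nth_less[OF assms] by (simp_all add: words_def)
  have ups: "w[r := k] \<in> words n q" if "k < q" for r k
    using assms that set_update_subset_insert[of w r k] by (auto simp: words_def)
  let ?P = "Sigma {..<n} (\<lambda>r. {..<q} - {w ! r})"
  have diff: "{t. t < n \<and> w ! t \<noteq> w[r := k] ! t} = {r}" if "r < n" "k \<noteq> w ! r" for r k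
    using that w by (auto simp: nth_list_update)
  have "{y. hamming_adj n q w y} = (\<lambda>(r, k). w[r := k]) ` ?P"
  proof (intro set_eqI iffI)
    fix y assume "y \<in> {y. hamming_adj n q w y}"
    then have y: "y \<in> words n q" and "card {t. t < n \<and> w ! t \<noteq> y ! t} = 1"
      by (auto simp: hamming_adj_def)
    then obtain r where r: "{t. t < n \<and> w ! t \<noteq> y ! t} = {r}" by (auto simp: card_1_singleton_iff)
    have ly: "length y = n" using y by (simp add: words_def)
    have "r < n" "w ! r \<noteq> y ! r" using r by auto
    moreover have "y = w[r := y ! r]"
    proof (rule nth_equalityI)
      fix t assume "t < length y"
      moreover from this have "w ! t = y ! t" if "t \<noteq> r" using r that ly by blast
      ultimately show "y ! t = w[r := y ! r] ! t" using w(1) ly by (cases "t = r") simp_all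
    qed (simp add: w(1) ly)
    moreover have "y ! r < q" using y \<open>r < n\<close> by (rule words_nth_less)
    ultimately show "y \<in> (\<lambda>(r, k). w[r := k]) ` ?P" by (intro image_eqI[of _ _ "(r, y ! r)"]) auto
  next
    fix y assume "y \<in> (\<lambda>(r, k). w[r := k]) ` ?P"
    then show "y \<in> {y. hamming_adj n q w y}"
      using assms ups diff by (auto simp: hamming_adj_def)
  qed
  moreover have "inj_on (\<lambda>(r, k). w[r := k]) ?P"
  proof (rule inj_onI)
    fix p p' assume "p \<in> ?P" "p' \<in> ?P" "(\<lambda>(r, k). w[r := k]) p = (\<lambda>(r, k). w[r := k]) p'"
    then obtain r k s l where p: "p = (r, k)" "p' = (s, l)"
      and a: "r < n" "k \<noteq> w ! r" "s < n" "l \<noteq> w ! s" "w[r := k] = w[s := l]" by auto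
    have "{r} = {t. t < n \<and> w ! t \<noteq> w[r := k] ! t}" using diff[OF a(1,2)] by simp
    also have "\<dots> = {s}" unfolding a(5) using diff[OF a(3,4)] .
    finally have "r = s" by simp
    moreover have "k = w[r := k] ! r" using a(1) w(1) by simp
    ultimately show "p = p'" unfolding p a(5) using a(3) w(1) by simp
  qed
  ultimately have "(\<Sum>y\<in>{y. hamming_adj n q w y}. f y) = (\<Sum>r<n. \<Sum>k\<in>{..<q} - {w ! r}. f (w[r := k]))"
    by (simp add: sum.reindex sum.Sigma case_prod_unfold)
  moreover have "(\<Sum>k<q. f (w[r := k])) = f w + (\<Sum>k\<in>{..<q} - {w ! r}. f (w[r := k]))" if "r < n" for r
    using w(2)[OF that] by (simp add: sum.remove[of "{..<q}" "w ! r"])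
  ultimately show ?thesis by (simp add: sum.distrib)
qed

lemma band_of_U_sum:
  assumes "0 < q" "j \<le> n" "f \<in> U_sum n q i j"
  shows "band q n {..<n} i (n - j) (\<lambda>x. f (map x [0..<n]))"
proof -
  obtain g where g: "\<And>t. t \<in> {i..j} \<Longrightarrow> g t \<in> U n q t"
    and f: "\<And>w. w \<in> words n q \<Longrightarrow> f w = (\<Sum>t=i..j. g t w)"
    using assms(3) unfolding U_sum_def by blast
  have words: "map x [0..<n] \<in> words n q" if "x \<in> cube q {..<n}" for x
    using bij_betw_cube_words[of n q] that by (auto simp: bij_betw_def)
  have "band q n {..<n} i (n - j) (\<lambda>x. g t (map x [0..<n]))" if "t \<in> {i..j}" for t
  proof (rule band_of_eigenfunction[OF assms(1), of _ _ _ "real t"])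
    fix x assume x: "x \<in> cube q {..<n}"
    have upd: "(map x [0..<n])[r := k] = map (x(r := k)) [0..<n]" if "r < n" for r k
      using that by (intro nth_equalityI) (auto simp: nth_list_update)
    have "hamming_eigenvalue n q t * g t (map x [0..<n]) =
        (\<Sum>y\<in>{y. hamming_adj n q (map x [0..<n]) y}. g t y)"
      using g[OF that] words[OF x] by (simp add: U_def eigenfunction_def)
    then have "(\<Sum>r<n. \<Sum>k<q. g t ((map x [0..<n])[r := k])) =
        hamming_eigenvalue n q t * g t (map x [0..<n]) + real n * g t (map x [0..<n])"
      using sum_hamming_adj[OF words[OF x], of "g t"] by simp
    \<comment> \<open>Adding n to the eigenvalue n (q - 1) - q t gives q (n - t).\<close>
    also have "\<dots> = real q * (real n - real t) * g t (map x [0..<n])"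
      by (simp add: hamming_eigenvalue_def algebra_simps)
    finally show "(\<Sum>r<n. \<Sum>k<q. slice r k (\<lambda>x. g t (map x [0..<n])) x) =
        real q * (real n - real t) * g t (map x [0..<n])"
      by (simp add: slice_def upd del: fun_upd_apply)
  qed (use that assms(2) in auto)
  then have "band q n {..<n} i (n - j) (\<lambda>x. \<Sum>t=i..j. g t (map x [0..<n]))"
    by (intro band_sum) auto
  then show ?thesis using f words by (simp cong: band_cong)
qed

lemma supp_size_cong:
  assumes "\<And>w. w \<in> words n q \<Longrightarrow> f w = 0 \<longleftrightarrow> g w = 0"
  shows "supp_size n q f = supp_size n q g"
  unfolding supp_size_def using assms by (metis (mono_tags, lifting))

lemma supp_size_permute_coords:
  assumes "\<sigma> permutes {..<n}"
  shows "supp_size n q (permute_coords n \<sigma> f) = supp_size n q f"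
proof -
  have lt: "\<tau> k < n" if "\<tau> permutes {..<n}" "k < n" for \<tau> k
    using permutes_in_image[OF that(1), of k] that(2) by simp
  have perm: "map (\<lambda>k. w ! \<tau> k) [0..<n] \<in> words n q" if "w \<in> words n q" "\<tau> permutes {..<n}" for w \<tau>
    using words_nth_less[OF that(1)] lt[OF that(2)] by (auto simp: words_def)
  have inv: "map (\<lambda>k. map (\<lambda>k. w ! \<tau> k) [0..<n] ! \<rho> k) [0..<n] = w"
    if "w \<in> words n q" "\<rho> permutes {..<n}" "\<And>k. \<tau> (\<rho> k) = k" for w \<tau> \<rho>
    using that lt[OF that(2)] by (intro nth_equalityI) (auto simp: words_def)
  have \<sigma>': "inv \<sigma> permutes {..<n}" using assms by (rule permutes_inv)
  have "bij_betw (\<lambda>w. map (\<lambda>k. w ! \<sigma> k) [0..<n]) (words n q) (words n q)"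
  proof (rule bij_betw_byWitness[where f' = "\<lambda>w. map (\<lambda>k. w ! inv \<sigma> k) [0..<n]"])
    show "\<forall>w\<in>words n q. map (\<lambda>k. map (\<lambda>k. w ! \<sigma> k) [0..<n] ! inv \<sigma> k) [0..<n] = w"
      using inv[OF _ \<sigma>'] permutes_inverses(1)[OF assms] by blast
    show "\<forall>w\<in>words n q. map (\<lambda>k. map (\<lambda>k. w ! inv \<sigma> k) [0..<n] ! \<sigma> k) [0..<n] = w"
      using inv[OF _ assms] permutes_inverses(2)[OF assms] by blast
  qed (use perm assms \<sigma>' in auto)
  then have "bij_betw (\<lambda>w. map (\<lambda>k. w ! \<sigma> k) [0..<n])
      {w \<in> words n q. permute_coords n \<sigma> f w \<noteq> 0} {w \<in> words n q. f w \<noteq> 0}"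
    unfolding permute_coords_def by (rule bij_betw_Collect) simp
  then show ?thesis unfolding supp_size_def by (rule bij_betw_same_card)
qed

section \<open>Support sizes of products, and the passage to \<open>F2\<close>\<close>

lemma supp_size_block_prod_Cons:
  "supp_size (m + n) q (block_prod ((m, g) # fs)) = supp_size m q g * supp_size n q (block_prod fs)"
proof -
  let ?A = "{w \<in> words m q. g w \<noteq> 0}" and ?B = "{w \<in> words n q. block_prod fs w \<noteq> 0}"
  have "{w \<in> words (m + n) q. block_prod ((m, g) # fs) w \<noteq> 0} = (\<lambda>(u, v). u @ v) ` (?A \<times> ?B)"
  proof (intro set_eqI iffI)
    fix w assume w: "w \<in> {w \<in> words (m + n) q. block_prod ((m, g) # fs) w \<noteq> 0}"
    have "set (take m w) \<subseteq> set w" "set (drop m w) \<subseteq> set w" by (simp_all add: set_take_subset set_drop_subset)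
    with w have "(take m w, drop m w) \<in> ?A \<times> ?B" by (auto simp: words_def)
    then show "w \<in> (\<lambda>(u, v). u @ v) ` (?A \<times> ?B)" by (metis (mono_tags, lifting) append_take_drop_id case_prod_conv image_eqI)
  qed (auto simp: words_def)
  moreover have "inj_on (\<lambda>(u, v). u @ v) (?A \<times> ?B)"
    by (auto simp: inj_on_def words_def)
  ultimately show ?thesis by (simp add: supp_size_def card_image card_cartesian_product)
qed

lemma words_1: "words 1 q = (\<lambda>x. [x]) ` {..<q}"
  by (auto simp: words_def length_Suc_conv)

lemma words_2: "words 2 q = (\<lambda>(x, y). [x, y]) ` ({..<q} \<times> {..<q})"
  by (auto simp: words_def length_Suc_conv numeral_2_eq_2)

lemma supp_size_A1:
  assumes "g \<in> A1 q"
  shows "supp_size 2 q g = 2 * (q - 1)"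
proof -
  obtain k m where g: "g = a1 k m" "k < q" "m < q" using assms by (auto simp: A1_def)
  let ?A = "{k} \<times> ({..<q} - {m})" and ?B = "({..<q} - {k}) \<times> {m}"
  have "{w \<in> words 2 q. g w \<noteq> 0} = (\<lambda>(x, y). [x, y]) ` (?A \<union> ?B)"
    unfolding words_2 using g by (auto simp: a1_def)
  moreover have "inj_on (\<lambda>(x, y). [x, y]) (?A \<union> ?B)" by (auto simp: inj_on_def)
  moreover have "card (?A \<union> ?B) = card ?A + card ?B" by (intro card_Un_disjoint) auto
  ultimately show ?thesis using g by (simp add: supp_size_def card_image card_cartesian_product)
qed

lemma supp_size_A2:
  assumes "h \<in> A2 q"
  shows "supp_size 1 q h = 2"
proof -
  obtain k m where h: "h = a2 k m" "k < q" "m < q" "k \<noteq> m" using assms by (auto simp: A2_def)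
  have "{w \<in> words 1 q. h w \<noteq> 0} = {[k], [m]}"
    unfolding words_1 using h by (auto simp: a2_def)
  then show ?thesis using h by (simp add: supp_size_def)
qed

lemma supp_size_block_prod:
  assumes "set gs \<subseteq> A1 q" "set hs \<subseteq> A2 q"
  shows "supp_size (2 * length gs + length hs) q (block_prod (map (Pair 2) gs @ map (Pair 1) hs)) =
    (2 * (q - 1)) ^ length gs * 2 ^ length hs"
  using assms(1)
proof (induction gs)
  case Nil
  show ?case using assms(2)
  proof (induction hs)
    case Nil
    have "{w \<in> words 0 q. block_prod [] w \<noteq> 0} = {[]}" by (auto simp: words_def)
    then show ?case by (simp add: supp_size_def)
  next
    case (Cons h hs)
    then show ?case
      using supp_size_block_prod_Cons[of 1 "length hs" q h "map (Pair 1) hs"] supp_size_A2[of h q]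
      by (simp del: block_prod.simps)
  qed
next
  case (Cons g gs)
  then show ?case
    using supp_size_block_prod_Cons[of 2 "2 * length gs + length hs" q g "map (Pair 2) gs @ map (Pair 1) hs"]
      supp_size_A1[of g q] by (simp add: mult.assoc del: block_prod.simps)
qed

lemma supp_size_of_F2:
  assumes "i \<le> n" "n \<le> 2 * i" "\<sigma> permutes {..<n}" "permute_coords n \<sigma> f \<in> F2 n q i i"
    "\<exists>w\<in>words n q. f w \<noteq> 0"
  shows "supp_size n q f = 2 ^ i * (q - 1) ^ (n - i)"
proof -
  obtain c gs hs vs where gs: "length gs = n - i" "set gs \<subseteq> A1 q"
    and hs: "length hs = i + i - n" "set hs \<subseteq> A2 q" and vs: "length vs = i - i"
    and f: "\<forall>w\<in>words n q. permute_coords n \<sigma> f w =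
      c * block_prod (map (Pair 2) gs @ map (Pair 1) hs @ map (Pair 1) vs) w"
    using assms(4) unfolding F2_def mem_Collect_eq by (elim exE conjE) (rule that)
  have f: "permute_coords n \<sigma> f w = c * block_prod (map (Pair 2) gs @ map (Pair 1) hs) w"
    if "w \<in> words n q" for w using f vs that by simp
  have "supp_size n q f \<noteq> 0" using assms(5) by (auto simp: supp_size_def finite_words)
  then have ne: "supp_size n q (permute_coords n \<sigma> f) \<noteq> 0" using assms(3) by (simp add: supp_size_permute_coords)
  have "c \<noteq> 0"
  proof
    assume "c = 0"
    then have "{w \<in> words n q. permute_coords n \<sigma> f w \<noteq> 0} = {}" using f by auto
    then have "supp_size n q (permute_coords n \<sigma> f) = 0" unfolding supp_size_def by (simp only: card.empty)
    then show False using ne by simp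
  qed
  have "supp_size n q f = supp_size n q (permute_coords n \<sigma> f)"
    using assms(3) by (simp add: supp_size_permute_coords)
  also have "\<dots> = supp_size n q (block_prod (map (Pair 2) gs @ map (Pair 1) hs))"
    using f \<open>c \<noteq> 0\<close> by (intro supp_size_cong) simp
  also have "\<dots> = (2 * (q - 1)) ^ (n - i) * 2 ^ (i + i - n)"
    using supp_size_block_prod[OF gs(2) hs(2)] gs(1) hs(1) assms(1,2) by (simp add: algebra_simps)
  also have "\<dots> = 2 ^ ((n - i) + (i + i - n)) * (q - 1) ^ (n - i)"
    unfolding power_mult_distrib power_add by (simp only: mult_ac)
  also have "(n - i) + (i + i - n) = i" using assms(1,2) by simp
  finally show ?thesis .
qed

lemma F2_of_product_form:
  assumes "product_form q {..<n} (n - i) (i - (n - i)) (\<lambda>x. f (map x [0..<n]))" "i \<le> n"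
  shows "\<exists>\<sigma>. \<sigma> permutes {..<n} \<and> permute_coords n \<sigma> f \<in> F2 n q i i"
proof -
  obtain rs gs hs c where rs: "distinct rs" "set rs = {..<n}"
    and gs: "length gs = n - i" "set gs \<subseteq> A1 q" and hs: "length hs = i - (n - i)" "set hs \<subseteq> A2 q"
    and f: "\<And>x. x \<in> cube q {..<n} \<Longrightarrow>
      f (map x [0..<n]) = c * block_prod (map (Pair 2) gs @ map (Pair 1) hs) (map x rs)"
    by (rule product_formE[OF assms(1)], rule that)
  have len: "length rs = n" using distinct_card[OF rs(1)] rs(2) by simp
  \<comment> \<open>\<open>\<pi>\<close> maps a position in the product to its coordinate. The point
    whose \<open>rs ! p\<close> entry is \<open>w ! p\<close> is \<open>w\<close> read through the
    inverse of \<open>\<pi>\<close>, so the required permutation is that inverse.\<close>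
  define \<pi> where "\<pi> k = (if k < n then rs ! k else k)" for k
  have "bij_betw ((!) rs) {..<n} {..<n}" using rs len by (intro bij_betw_nth) auto
  moreover have "bij_betw \<pi> {..<n} {..<n} \<longleftrightarrow> bij_betw ((!) rs) {..<n} {..<n}"
    by (rule bij_betw_cong) (simp add: \<pi>_def)
  ultimately have "bij_betw \<pi> {..<n} {..<n}" by blast
  then have \<pi>: "\<pi> permutes {..<n}" by (rule bij_imp_permutes) (simp add: \<pi>_def)
  have "permute_coords n (inv \<pi>) f w = c * block_prod (map (Pair 2) gs @ map (Pair 1) hs) w"
    if w: "w \<in> words n q" for w
  proof -
    let ?x = "restrict (\<lambda>k. w ! inv \<pi> k) {..<n}"
    have "inv \<pi> k < n" if "k < n" for k
      using permutes_in_image[OF permutes_inv[OF \<pi>], of k] that by simp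
    then have x: "?x \<in> cube q {..<n}"
      using words_nth_less[OF w] by (simp add: cube_def restrict_PiE_iff)
    have "map ?x rs = w"
    proof (rule nth_equalityI)
      fix p assume "p < length (map ?x rs)"
      then have p: "p < n" using len by simp
      then have "rs ! p \<in> {..<n}" using len rs(2) nth_mem by blast
      moreover have "inv \<pi> (rs ! p) = p" using permutes_inverses(2)[OF \<pi>, of p] p by (simp add: \<pi>_def)
      ultimately show "map ?x rs ! p = w ! p" using p len by simp
    qed (use len w in \<open>simp add: words_def\<close>)
    moreover have "map ?x [0..<n] = map (\<lambda>k. w ! inv \<pi> k) [0..<n]" by simp
    ultimately show ?thesis using f[OF x] by (simp only: permute_coords_def)
  qed
  then have "\<forall>w\<in>words n q. permute_coords n (inv \<pi>) f w =
      c * block_prod (map (Pair 2) gs @ map (Pair 1) hs @ map (Pair 1) []) w" by simp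
  then have "permute_coords n (inv \<pi>) f \<in> F2 n q i i"
    unfolding F2_def mem_Collect_eq
    by (intro exI[of _ c] exI[of _ gs] exI[of _ hs] exI[of _ "[]"] conjI) (use gs hs assms(2) in simp_all)
  then show ?thesis using permutes_inv[OF \<pi>] by blast
qed

theorem theorem3:
  fixes n q i j :: nat and f :: "nat list \<Rightarrow> real"
  assumes "q \<ge> 4"
    and "i \<le> j" and "j \<le> n" and "i + j > n"
    and "f \<in> U_sum n q i j"
    and "\<exists>x\<in>words n q. f x \<noteq> 0"
  shows "supp_size n q f \<ge> 2 ^ i * (q - 1) ^ (n - j) \<and>
    (i = j \<and> q \<ge> 5 \<longrightarrow>
      (supp_size n q f = 2 ^ i * (q - 1) ^ (n - i) \<longleftrightarrow>
       (\<exists>\<sigma>. \<sigma> permutes {..<n} \<and> permute_coords n \<sigma> f \<in> F2 n q i i)))"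
proof -
  let ?F = "\<lambda>x. f (map x [0..<n])"
  have band: "band q n {..<n} i (n - j) ?F" using assms by (intro band_of_U_sum) auto
  have "supp_size n q f \<noteq> 0" using assms(6) by (auto simp: supp_size_def finite_words)
  then have "band_bound q i (n - j) \<le> supp_size n q f"
    using band_bound_le_supp_card[OF assms(1) _ _ band] by (simp add: supp_size_eq_supp_card)
  \<comment> \<open>Thus i + j > n selects the second branch of \<open>band_bound\<close>.\<close>
  moreover have "\<not> i \<le> n - j" using assms(3,4) by simp
  ultimately have bound: "2 ^ i * (q - 1) ^ (n - j) \<le> supp_size n q f" by (simp add: band_bound_def)
  moreover have "supp_size n q f = 2 ^ i * (q - 1) ^ (n - i) \<longleftrightarrow>
       (\<exists>\<sigma>. \<sigma> permutes {..<n} \<and> permute_coords n \<sigma> f \<in> F2 n q i i)" if "i = j" "q \<ge> 5"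
  proof
    assume "supp_size n q f = 2 ^ i * (q - 1) ^ (n - i)"
    then have "product_form q {..<n} (n - i) (i - (n - i)) ?F"
      using band that assms(3,4) by (intro band_bound_equality) (auto simp: supp_size_eq_supp_card)
    then show "\<exists>\<sigma>. \<sigma> permutes {..<n} \<and> permute_coords n \<sigma> f \<in> F2 n q i i"
      using assms(3) that by (intro F2_of_product_form) auto
  next
    assume "\<exists>\<sigma>. \<sigma> permutes {..<n} \<and> permute_coords n \<sigma> f \<in> F2 n q i i"
    then show "supp_size n q f = 2 ^ i * (q - 1) ^ (n - i)"
      using supp_size_of_F2[OF _ _ _ _ assms(6), of i] assms(3,4) that by auto
  qed
  ultimately show ?thesis by blast
qed

end
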